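(* Let $1/2<\alpha\le1$ and let $X_1,\dots,X_n$ be i.i.d. with probability density $f_0$ on $[0,1]$ such that $0<\rho_0\le f_0\le D_0<\infty$ for some constants $\rho_0,D_0$, and $f_0\in\mathcal C^\alpha[0,1]$. Let $h_n=(n/\log n)^{-1/(2\alpha+1)}$, $L=L_n=\lfloor\log_2(1/h_n)\rfloor$, and let the prior $\Pi$ be the law of the random histogram $$f(x)=2^{L}\sum_{k=0}^{2^{L}-1}\omega_k\mathbf 1_{I_k^{L}}(x),$$ where $I_0^L=[0,2^{-L}]$, $I_k^L=(k2^{-L},(k+1)2^{-L}]$ for $1\le k\le2^L-1$, and $(\omega_0,\dots,\omega_{2^L-1})$ has the Dirichlet distribution $\mathcal D(\alpha_0,\dots,\alpha_{2^L-1})$ on the unit simplex, with parameters $\alpha_k=\alpha_{k,L_n}$ (allowed to depend on $n$) satisfying $c_12^{-La}\le\alpha_k\le c_2$ for all $k$ and $n$, for some fixed constants $a,c_1,c_2>0$. Then for every sequence $M_n\to\infty$, $$E_{f_0}^n\,\Pi\Big[f:\|f-f_0\|_\infty>M_n\Big(\frac{\log n}{n}\Big)^{\alpha/(2\alpha+1)}\,\Big|\,X^{(n)}\Big]\to0\quad(n\to\infty).$$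
   Context: $\mathcal C^\alpha[0,1]$ for $0<\alpha\le1$ is the space of functions $g$ with $|g(x)-g(y)|\le C|x-y|^\alpha$ for some $C$ (for $\alpha=1$: Lipschitz). The posterior is $\Pi(B\mid X^{(n)})=\int_B\prod_i f(X_i)\,d\Pi(f)/\int\prod_if(X_i)\,d\Pi(f)$, and $E^n_{f_0}$ is expectation under $X_1,\dots,X_n$ i.i.d. $f_0$. *)

theory Defs
  imports "HOL-Probability.Probability"
begin

definition dyadic_interval :: "nat \<Rightarrow> nat \<Rightarrow> real set" where
  "dyadic_interval L k =
     (if k = 0 then {0 .. 2 powr (- real L)}
      else {real k * 2 powr (- real L) <.. (real k + 1) * 2 powr (- real L)})"

definition histogram :: "nat \<Rightarrow> (nat \<Rightarrow> real) \<Rightarrow> real \<Rightarrow> real" where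
  "histogram L w x = 2 ^ L * (\<Sum>k<2 ^ L. w k * indicator (dyadic_interval L k) x)"

text \<open>Dirichlet density D(a_0,...,a_{K-1}), with respect to Lebesgue measure on the
  first K-1 coordinates of the unit simplex.\<close>
definition dirichlet_density :: "nat \<Rightarrow> (nat \<Rightarrow> real) \<Rightarrow> (nat \<Rightarrow> real) \<Rightarrow> real" where
  "dirichlet_density K a w =
     (if (\<forall>k<K-1. 0 < w k) \<and> (\<Sum>k<K-1. w k) < 1 then
        Gamma (\<Sum>k<K. a k) / (\<Prod>k<K. Gamma (a k))
        * (\<Prod>k<K-1. w k powr (a k - 1))
        * (1 - (\<Sum>k<K-1. w k)) powr (a (K-1) - 1)
      else 0)"

definition dirichlet :: "nat \<Rightarrow> (nat \<Rightarrow> real) \<Rightarrow> (nat \<Rightarrow> real) measure" where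
  "dirichlet K a =
     distr (density (PiM {..<K-1} (\<lambda>_. lborel)) (\<lambda>w. ennreal (dirichlet_density K a w)))
           (PiM UNIV (\<lambda>_. borel))
           (\<lambda>w k. if k < K-1 then w k else if k = K-1 then 1 - (\<Sum>j<K-1. w j) else 0)"

text \<open>Posterior probability of a set B of densities, for the prior given by the law
  of the random histogram at level L with Dirichlet(a) weights, given data xs_0..xs_{n-1}:
  Pi(B | X) = int_B prod f(X_i) dPi(f) / int prod f(X_i) dPi(f), written via the weights.\<close>
definition hist_posterior ::
  "nat \<Rightarrow> (nat \<Rightarrow> real) \<Rightarrow> nat \<Rightarrow> (nat \<Rightarrow> real) \<Rightarrow> (real \<Rightarrow> real) set \<Rightarrow> ennreal" where
  "hist_posterior L a n xs B =
     (\<integral>\<^sup>+ w. indicator B (histogram L w) * ennreal (\<Prod>i<n. histogram L w (xs i)) \<partial>dirichlet (2 ^ L) a)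
     / (\<integral>\<^sup>+ w. ennreal (\<Prod>i<n. histogram L w (xs i)) \<partial>dirichlet (2 ^ L) a)"

definition iid_sample :: "(real \<Rightarrow> real) \<Rightarrow> nat \<Rightarrow> (nat \<Rightarrow> real) measure" where
  "iid_sample f0 n = PiM {..<n} (\<lambda>_. density lborel (\<lambda>x. ennreal (f0 x * indicator {0..1} x)))"

definition sup_dist01 :: "(real \<Rightarrow> real) \<Rightarrow> (real \<Rightarrow> real) \<Rightarrow> real" where
  "sup_dist01 f g = (SUP x\<in>{0..1}. \<bar>f x - g x\<bar>)"

definition holder01 :: "real \<Rightarrow> (real \<Rightarrow> real) \<Rightarrow> bool" where
  "holder01 \<alpha> g \<longleftrightarrow> (\<exists>C. \<forall>x\<in>{0..1}. \<forall>y\<in>{0..1}. \<bar>g x - g y\<bar> \<le> C * \<bar>x - y\<bar> powr \<alpha>)"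

end

theory Submission
  imports Defs
begin

text \<open>
  The Dirichlet prior is conjugate: given the bin counts $N_k$, every posterior moment of the
  weights is a ratio of multivariate Beta functions, with parameters $\alpha_k + N_k$. On the event
  that every $N_k$ is within $nt/2$ of $n p_k$, where $p_k$ is the mass that $f_0$ gives to the $k$-th bin,
  Markov's inequality for $\omega_k^m$ and $\omega_k^{-m}$ with $m \approx nt/16$ bounds the
  posterior probability of $|\omega_k - p_k| > t$ by a multiple of $\exp(-nt^2/(256 p_k))$;
  Chernoff's bound for the binomial variable $N_k$ controls the exceptional event at the same
  scale. With $t$ a constant multiple of $2^{-L}\varepsilon_n$, where
  $\varepsilon_n = (\log n/n)^{\alpha/(2\alpha+1)}$, the exponent is a multiple of $\log n$ and
  beats the number $2^L \le n$ of bins, while the Hoelder condition makes the bias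
  $|2^L p_k - f_0|$ of order $\varepsilon_n$. Since $M_n \to \infty$, it suffices to treat one
  sufficiently large constant in place of $M_n$.
\<close>

section \<open>Moments of the Dirichlet distribution\<close>

text \<open>The substitution y = s x reduces this to the Beta integral on the unit interval. It
  integrates out one coordinate of the simplex, s being the mass that the other coordinates
  leave.\<close>

lemma nn_integral_beta_scaled:
  fixes a b s :: real
  assumes "0 < a" "0 < b" "0 < s"
  shows "(\<integral>\<^sup>+ y. ennreal (indicator {0<..<s} y * (y powr (a - 1) * (s - y) powr (b - 1))) \<partial>lborel)
     = ennreal (Beta a b * s powr (a + b - 1))"
proof -
  have "(\<integral>\<^sup>+ y. ennreal (indicator {0<..<s} y * (y powr (a - 1) * (s - y) powr (b - 1))) \<partial>lborel)
     = ennreal s * (\<integral>\<^sup>+ x. ennreal (indicator {0<..<s} (s * x) *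
          ((s * x) powr (a - 1) * (s - s * x) powr (b - 1))) \<partial>lborel)"
    using \<open>0 < s\<close> by (subst nn_integral_real_affine[where c = s and t = 0]) auto
  also have "\<dots> = ennreal s * (\<integral>\<^sup>+ x. ennreal (s powr (a + b - 2)) * 
      ennreal (indicator {0..1} x * (x powr (a - 1) * (1 - x) powr (b - 1))) \<partial>lborel)"
  proof (intro arg_cong[where f = "\<lambda>z. ennreal s * z"] nn_integral_cong_AE)
    have "AE x in lborel. x \<noteq> (0::real)" "AE x in lborel. x \<noteq> (1::real)"
      by (rule AE_lborel_singleton)+
    then show "AE x in lborel. ennreal (indicator {0<..<s} (s * x) *
          ((s * x) powr (a - 1) * (s - s * x) powr (b - 1))) = ennreal (s powr (a + b - 2)) * 
      ennreal (indicator {0..1} x * (x powr (a - 1) * (1 - x) powr (b - 1)))"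
    proof eventually_elim
      case (elim x)
      show ?case
      proof (cases "0 < x \<and> x < 1")
        case True
        have "s - s * x = s * (1 - x)" by (simp add: algebra_simps)
        moreover have "s powr (a + b - 2) = s powr (a - 1) * s powr (b - 1)"
          by (simp add: powr_add[symmetric])
        ultimately show ?thesis using True \<open>0 < s\<close>
          by (simp add: powr_mult ennreal_mult[symmetric] mult_ac)
      next
        case False
        with elim have "x < 0 \<or> 1 < x" by auto
        then show ?thesis using \<open>0 < s\<close> by (auto simp: indicator_def zero_less_mult_iff)
      qed
    qed
  qed
  also have "\<dots> = ennreal s * (ennreal (s powr (a + b - 2)) * ennreal (Beta a b))"
  proof -
    have "(\<integral>\<^sup>+ x. ennreal (indicator {0..1} x * (x powr (a - 1) * (1 - x) powr (b - 1))) \<partial>lborel)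
        = ennreal (Beta a b)"
      by (rule nn_integral_has_integral_lebesgue[OF _ has_integral_Beta_real]) (use assms in auto)
    then show ?thesis by (subst nn_integral_cmult) auto
  qed
  also have "\<dots> = ennreal (Beta a b * (s powr 1 * s powr (a + b - 2)))"
    using assms by (simp add: ennreal_mult'[symmetric] mult_ac Beta_def)
  also have "s powr 1 * s powr (a + b - 2) = s powr (a + b - 1)"
    by (simp only: powr_add[symmetric]) simp
  finally show ?thesis .
qed

definition multi_beta :: "nat \<Rightarrow> (nat \<Rightarrow> real) \<Rightarrow> real" where
  "multi_beta K b = (\<Prod>k<K. Gamma (b k)) / Gamma (\<Sum>k<K. b k)"

text \<open>Unnormalised Dirichlet density in d free coordinates. The parameter \<open>b d\<close>
  belongs to the last weight, which is determined by the others; \<open>multi_beta (Suc d) b\<close>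
  is its total mass.\<close>

definition dirichlet_kernel :: "nat \<Rightarrow> (nat \<Rightarrow> real) \<Rightarrow> (nat \<Rightarrow> real) \<Rightarrow> real" where
  "dirichlet_kernel d b w =
     (if (\<forall>k<d. 0 < w k) \<and> (\<Sum>k<d. w k) < 1 then
        (\<Prod>k<d. w k powr (b k - 1)) * (1 - (\<Sum>k<d. w k)) powr (b d - 1)
      else 0)"

lemma dirichlet_kernel_nonneg: "0 \<le> dirichlet_kernel d b w"
  by (auto simp: dirichlet_kernel_def intro!: mult_nonneg_nonneg prod_nonneg)

lemma measurable_dirichlet_kernel [measurable]:
  "dirichlet_kernel d b \<in> borel_measurable (PiM {..<d} (\<lambda>_. lborel))"
  unfolding dirichlet_kernel_def by measurable

lemma Gamma_real_nonzero: "0 < x \<Longrightarrow> Gamma (x :: real) \<noteq> 0"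
  using Gamma_real_pos[of x] by linarith

lemma multi_beta_pos:
  assumes "\<And>k. k < Suc d \<Longrightarrow> 0 < b k"
  shows "0 < multi_beta (Suc d) b"
  unfolding multi_beta_def using assms
  by (intro divide_pos_pos prod_pos Gamma_real_pos sum_pos) auto

text \<open>Induction on d: integrating out the last free coordinate produces a Beta factor and
  merges the parameters \<open>b d\<close> and \<open>b (Suc d)\<close> into their sum, which leaves
  the kernel with one coordinate fewer. The Gamma value of the merged parameter cancels.\<close>

lemma nn_integral_dirichlet_kernel:
  assumes "\<And>k. k < Suc d \<Longrightarrow> 0 < b k"
  shows "(\<integral>\<^sup>+ w. ennreal (dirichlet_kernel d b w) \<partial>PiM {..<d} (\<lambda>_. lborel))
     = ennreal (multi_beta (Suc d) b)"
  using assms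
proof (induction d arbitrary: b)
  case 0
  have "Gamma (b 0) \<noteq> 0" using 0 by (intro Gamma_real_nonzero) auto
  then show ?case
    by (simp add: dirichlet_kernel_def multi_beta_def lessThan_0 PiM_empty nn_integral_count_space_finite)
next
  case (Suc d)
  interpret product_sigma_finite "\<lambda>_::nat. lborel :: real measure"
    by standard
  let ?b = "b(d := b d + b (Suc d))"
  have pos: "0 < b d" "0 < b (Suc d)" using Suc.prems by auto
  have inner: "(\<integral>\<^sup>+ y. ennreal (dirichlet_kernel (Suc d) b (x(d := y))) \<partial>lborel)
      = ennreal (Beta (b d) (b (Suc d))) * ennreal (dirichlet_kernel d ?b x)" for x :: "nat \<Rightarrow> real"
  proof (cases "(\<forall>k<d. 0 < x k) \<and> (\<Sum>k<d. x k) < 1")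
    case True
    let ?S = "\<Sum>k<d. x k"
    let ?P = "\<Prod>k<d. x k powr (b k - 1)"
    have "dirichlet_kernel (Suc d) b (x(d := y)) = ?P * (indicator {0<..<1 - ?S} y *
        (y powr (b d - 1) * (1 - ?S - y) powr (b (Suc d) - 1)))" for y
      using True by (auto simp: dirichlet_kernel_def indicator_def less_Suc_eq algebra_simps)
    then have "(\<integral>\<^sup>+ y. ennreal (dirichlet_kernel (Suc d) b (x(d := y))) \<partial>lborel)
        = ennreal ?P * ennreal (Beta (b d) (b (Suc d)) * (1 - ?S) powr (b d + b (Suc d) - 1))"
      using True pos
      by (simp only:) (subst ennreal_mult', auto simp: nn_integral_cmult nn_integral_beta_scaled intro!: prod_nonneg)
    moreover have "0 \<le> ?P" by (intro prod_nonneg) auto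
    moreover have "0 \<le> Beta (b d) (b (Suc d))" using pos by (simp add: Beta_def)
    ultimately show ?thesis using True
      by (simp add: dirichlet_kernel_def ennreal_mult[symmetric] mult_ac)
  next
    case False
    have "dirichlet_kernel (Suc d) b (x(d := y)) = 0" for y
    proof (rule ccontr)
      assume "dirichlet_kernel (Suc d) b (x(d := y)) \<noteq> 0"
      then have "(\<forall>k<Suc d. 0 < (x(d := y)) k)" "(\<Sum>k<Suc d. (x(d := y)) k) < 1"
        by (auto simp: dirichlet_kernel_def split: if_splits)
      then have "\<forall>k<d. 0 < x k" "0 < y" "(\<Sum>k<d. x k) + y < 1"
        by (auto simp: less_Suc_eq split: if_splits)
      with False show False by auto
    qed
    moreover have "dirichlet_kernel d ?b x = 0"
      unfolding dirichlet_kernel_def using False by (rule if_not_P)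
    ultimately show ?thesis by simp
  qed
  have "(\<integral>\<^sup>+ w. ennreal (dirichlet_kernel (Suc d) b w) \<partial>PiM {..<Suc d} (\<lambda>_. lborel))
      = (\<integral>\<^sup>+ x. \<integral>\<^sup>+ y. ennreal (dirichlet_kernel (Suc d) b (x(d := y))) \<partial>lborel \<partial>PiM {..<d} (\<lambda>_. lborel))"
    unfolding lessThan_Suc
    by (rule product_nn_integral_insert)
       (auto simp flip: lessThan_Suc)
  also have "\<dots> = ennreal (Beta (b d) (b (Suc d))) * ennreal (multi_beta (Suc d) ?b)"
  proof -
    have "(\<integral>\<^sup>+ x. ennreal (dirichlet_kernel d ?b x) \<partial>PiM {..<d} (\<lambda>_. lborel)) = ennreal (multi_beta (Suc d) ?b)"
      by (rule Suc.IH) (use Suc.prems pos in \<open>auto intro: add_pos_pos\<close>)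
    then show ?thesis unfolding inner by (subst nn_integral_cmult) auto
  qed
  also have "\<dots> = ennreal (Beta (b d) (b (Suc d)) * multi_beta (Suc d) ?b)"
  proof (rule ennreal_mult[symmetric])
    show "0 \<le> Beta (b d) (b (Suc d))" using pos by (simp add: Beta_def)
    show "0 \<le> multi_beta (Suc d) ?b"
      by (intro less_imp_le[OF multi_beta_pos]) (use pos Suc.prems in \<open>auto intro: add_pos_pos\<close>)
  qed
  also have "Beta (b d) (b (Suc d)) * multi_beta (Suc d) ?b = multi_beta (Suc (Suc d)) b"
  proof -
    have "Gamma (b d + b (Suc d)) \<noteq> 0" using pos by (intro Gamma_real_nonzero) auto
    then show ?thesis by (simp add: Beta_def multi_beta_def add_ac mult_ac)
  qed
  finally show ?case .
qed

lemma dirichlet_density_Suc: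
  "dirichlet_density (Suc d) a w = dirichlet_kernel d a w / multi_beta (Suc d) a"
  by (auto simp: dirichlet_density_def dirichlet_kernel_def multi_beta_def)

lemma measurable_dirichlet_density [measurable]:
  "dirichlet_density (Suc d) a \<in> borel_measurable (PiM {..<d} (\<lambda>_. lborel))"
  unfolding dirichlet_density_Suc by measurable

text \<open>The chart of the simplex that is pushed forward in \<open>dirichlet\<close>, for K = Suc
  d.\<close>

definition simplex_point :: "nat \<Rightarrow> (nat \<Rightarrow> real) \<Rightarrow> nat \<Rightarrow> real" where
  "simplex_point d w k = (if k < d then w k else if k = d then 1 - (\<Sum>j<d. w j) else 0)"

lemma measurable_simplex_point [measurable]:
  "simplex_point d \<in> measurable (PiM {..<d} (\<lambda>_. lborel)) (PiM UNIV (\<lambda>_. borel))"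
proof (rule measurable_PiM_single')
  fix k :: nat
  show "(\<lambda>w. simplex_point d w k) \<in> borel_measurable (PiM {..<d} (\<lambda>_. lborel))"
    unfolding simplex_point_def by (cases "k < d"; cases "k = d") simp_all
qed (auto simp: space_PiM)

lemma dirichlet_Suc:
  "dirichlet (Suc d) a = distr (density (PiM {..<d} (\<lambda>_. lborel)) (\<lambda>w. ennreal (dirichlet_density (Suc d) a w)))
     (PiM UNIV (\<lambda>_. borel)) (simplex_point d)"
  unfolding dirichlet_def simplex_point_def[abs_def] diff_Suc_1 ..

lemma sets_dirichlet [measurable_cong, simp]: "sets (dirichlet K a) = sets (PiM UNIV (\<lambda>_. borel))"
  by (simp add: dirichlet_def)

text \<open>The density vanishes off the open simplex. Positivity allows \<open>w k ^ N\<close> to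
  be written as \<open>w k powr real N\<close>, which would fail at \<open>w k = 0\<close> and N =
  0, where \<open>powr\<close> has the value 0; it also allows division by powers of
  \<open>w k\<close>.\<close>

lemma AE_dirichlet_pos:
  assumes "0 < K"
  shows "AE w in dirichlet K a. \<forall>k<K. 0 < w k"
proof -
  obtain d where K: "K = Suc d" using \<open>0 < K\<close> by (cases K) auto
  have "0 < simplex_point d w k" if "0 < dirichlet_density (Suc d) a w" "k < Suc d" for w k
    using that by (auto simp: simplex_point_def dirichlet_density_def less_Suc_eq split: if_splits)
  then show ?thesis
    unfolding dirichlet_Suc K
    by (subst AE_distr_iff) (auto simp: AE_density)
qed

text \<open>A monomial with exponents c turns the kernel with parameters a into the one with
  parameters a + c, so the moment is a ratio of normalising constants. Exponents may be negative as
  long as the new parameters stay positive; the lower tail needs this.\<close>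

lemma nn_integral_dirichlet_powr:
  assumes "0 < K" and a: "\<And>k. k < K \<Longrightarrow> 0 < a k" and ac: "\<And>k. k < K \<Longrightarrow> 0 < a k + c k"
  shows "(\<integral>\<^sup>+ w. ennreal (\<Prod>k<K. w k powr c k) \<partial>dirichlet K a)
     = ennreal (multi_beta K (\<lambda>k. a k + c k) / multi_beta K a)"
proof -
  obtain d where K: "K = Suc d" using \<open>0 < K\<close> by (cases K) auto
  have mb: "0 < multi_beta K a" unfolding K by (rule multi_beta_pos) (use a K in auto)
  have "(\<integral>\<^sup>+ w. ennreal (\<Prod>k<K. w k powr c k) \<partial>dirichlet K a)
    = (\<integral>\<^sup>+ w. ennreal (dirichlet_density K a w) * ennreal (\<Prod>k<K. simplex_point d w k powr c k)
         \<partial>PiM {..<d} (\<lambda>_. lborel))"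
    unfolding dirichlet_Suc K
    by (subst nn_integral_distr, simp, measurable, subst nn_integral_density) auto
  also have "\<dots> = (\<integral>\<^sup>+ w. ennreal (1 / multi_beta K a) * ennreal (dirichlet_kernel d (\<lambda>k. a k + c k) w)
         \<partial>PiM {..<d} (\<lambda>_. lborel))"
  proof (unfold K, rule nn_integral_cong)
    fix w :: "nat \<Rightarrow> real"
    show "ennreal (dirichlet_density (Suc d) a w) * ennreal (\<Prod>k<Suc d. simplex_point d w k powr c k)
       = ennreal (1 / multi_beta (Suc d) a) * ennreal (dirichlet_kernel d (\<lambda>k. a k + c k) w)"
    proof (cases "(\<forall>k<d. 0 < w k) \<and> (\<Sum>k<d. w k) < 1")
      case True
      have "(\<Prod>k<Suc d. simplex_point d w k powr c k)
          = (\<Prod>k<d. w k powr c k) * (1 - (\<Sum>k<d. w k)) powr c d"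
        by (simp add: simplex_point_def)
      moreover have "dirichlet_kernel d a w * ((\<Prod>k<d. w k powr c k) * (1 - (\<Sum>k<d. w k)) powr c d)
          = dirichlet_kernel d (\<lambda>k. a k + c k) w"
      proof -
        have "(\<Prod>k<d. w k powr (a k - 1)) * (\<Prod>k<d. w k powr c k) = (\<Prod>k<d. w k powr (a k + c k - 1))"
          unfolding prod.distrib[symmetric]
          by (rule prod.cong) (auto simp: powr_add[symmetric] algebra_simps)
        moreover have "s powr (a d - 1) * s powr c d = s powr (a d + c d - 1)" for s
          by (simp add: powr_add[symmetric] algebra_simps)
        moreover have "dirichlet_kernel d b w = (\<Prod>k<d. w k powr (b k - 1)) * (1 - (\<Sum>k<d. w k)) powr (b d - 1)" for b
          unfolding dirichlet_kernel_def using True by (rule if_P)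
        moreover have "p * q * (p' * q') = (p * p') * (q * q')" for p q p' q' :: real
          by simp
        ultimately show ?thesis by (simp only:)
      qed
      ultimately show ?thesis
        using mb dirichlet_kernel_nonneg[of d a w] unfolding K
        by (simp add: dirichlet_density_Suc ennreal_mult'[symmetric] mult_ac)
    next
      case False
      have "dirichlet_kernel d b w = 0" for b
        unfolding dirichlet_kernel_def using False by (rule if_not_P)
      then show ?thesis by (simp add: dirichlet_density_Suc)
    qed
  qed
  also have "\<dots> = ennreal (1 / multi_beta K a) * ennreal (multi_beta K (\<lambda>k. a k + c k))"
    using ac by (subst nn_integral_cmult) (auto simp: K nn_integral_dirichlet_kernel)
  also have "\<dots> = ennreal (multi_beta K (\<lambda>k. a k + c k) / multi_beta K a)"
    using mb by (simp add: ennreal_mult'[symmetric])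
  finally show ?thesis .
qed

text \<open>This is the m-th moment of the k-th weight under the Dirichlet law with parameters b.
  Only the Gamma values at \<open>b k\<close> and at the total mass change, and each changes by a
  rising factorial.\<close>

lemma multi_beta_shift_up:
  assumes "k < K" and b: "\<And>j. j < K \<Longrightarrow> 0 < b j"
  shows "multi_beta K (b(k := b k + real m)) / multi_beta K b
    = (\<Prod>j<m. (b k + real j) / ((\<Sum>i<K. b i) + real j))"
proof -
  let ?B = "\<Sum>i<K. b i"
  have B: "0 < ?B" using assms by (intro sum_pos) auto
  have nz: "x \<notin> \<int>\<^sub>\<le>\<^sub>0" if "0 < x" for x :: real
    using that nonpos_Ints_nonpos[of x] by force
  have sum: "(\<Sum>i<K. (b(k := b k + real m)) i) = ?B + real m"
    using \<open>k < K\<close> by (simp add: sum.remove[of "{..<K}" k])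
  have prod: "(\<Prod>i<K. Gamma ((b(k := b k + real m)) i)) = Gamma (b k + real m) * (\<Prod>i\<in>{..<K}-{k}. Gamma (b i))"
    using \<open>k < K\<close> by (subst prod.remove[of "{..<K}" k]) auto
  have prod': "(\<Prod>i<K. Gamma (b i)) = Gamma (b k) * (\<Prod>i\<in>{..<K}-{k}. Gamma (b i))"
    using \<open>k < K\<close> by (subst prod.remove[of "{..<K}" k]) auto
  have P: "(\<Prod>i\<in>{..<K}-{k}. Gamma (b i)) \<noteq> 0"
    using b by (auto simp: Gamma_real_nonzero)
  have "multi_beta K (b(k := b k + real m)) / multi_beta K b
    = (Gamma (b k + real m) / Gamma (b k)) / (Gamma (?B + real m) / Gamma ?B)"
    unfolding multi_beta_def sum prod prod' using P by (simp add: field_simps)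
  also have "\<dots> = pochhammer (b k) m / pochhammer ?B m"
    using b[OF \<open>k < K\<close>] B by (simp add: pochhammer_Gamma nz)
  also have "\<dots> = (\<Prod>j<m. (b k + real j) / (?B + real j))"
    by (simp add: pochhammer_prod prod_dividef atLeast0LessThan)
  finally show ?thesis .
qed

text \<open>The moment of order -m: the previous formula is applied at the lowered parameters and
  inverted.\<close>

lemma multi_beta_shift_down:
  assumes "k < K" and b: "\<And>j. j < K \<Longrightarrow> 0 < b j" and m: "real m < b k"
  shows "multi_beta K (b(k := b k - real m)) / multi_beta K b
    = (\<Prod>j<m. ((\<Sum>i<K. b i) - real m + real j) / (b k - real m + real j))"
proof -
  let ?b = "b(k := b k - real m)"
  have sum: "(\<Sum>i<K. ?b i) = (\<Sum>i<K. b i) - real m"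
    using \<open>k < K\<close> by (simp add: sum.remove[of "{..<K}" k])
  have "multi_beta K (?b(k := ?b k + real m)) / multi_beta K ?b
    = (\<Prod>j<m. (?b k + real j) / ((\<Sum>i<K. ?b i) + real j))"
    by (rule multi_beta_shift_up) (use assms in auto)
  then have "multi_beta K b / multi_beta K ?b
    = (\<Prod>j<m. (b k - real m + real j) / ((\<Sum>i<K. b i) - real m + real j))"
    unfolding sum by simp
  then have "inverse (multi_beta K b / multi_beta K ?b)
    = (\<Prod>j<m. inverse ((b k - real m + real j) / ((\<Sum>i<K. b i) - real m + real j)))"
    by (simp only: prod_inversef[symmetric] o_def)
  then show ?thesis by simp
qed

section \<open>Histograms and their posterior\<close>

text \<open>The bins are open on the left and closed on the right, hence the ceiling minus 1. At x =
  0 this gives -1, which \<open>nat\<close> sends to 0, in agreement with the first bin being closed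
  at 0.\<close>

definition dyadic_index :: "nat \<Rightarrow> real \<Rightarrow> nat" where
  "dyadic_index L x = nat (\<lceil>x * 2 ^ L\<rceil> - 1)"

lemma dyadic_index_less:
  assumes "x \<in> {0..1}"
  shows "dyadic_index L x < 2 ^ L"
proof -
  have "x * 2 ^ L \<le> 2 ^ L" using assms by (simp add: mult_left_le_one_le)
  then have "\<lceil>x * 2 ^ L\<rceil> \<le> 2 ^ L" by (simp add: ceiling_le_iff)
  then show ?thesis unfolding dyadic_index_def
    by (simp add: nat_less_iff) 
qed

lemma mem_dyadic_interval_iff:
  assumes "x \<in> {0..1}"
  shows "x \<in> dyadic_interval L k \<longleftrightarrow> k = dyadic_index L x"
proof -
  have pw: "2 powr (- real L) = 1 / 2 ^ L"
    by (simp add: powr_minus powr_realpow divide_inverse)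
  have x: "0 \<le> x" using assms by auto
  have c0: "0 \<le> \<lceil>x * 2 ^ L\<rceil>" using x by (simp add: less_le_trans[of "-1" 0])
  show ?thesis
  proof (cases "k = 0")
    case True
    have "x \<in> dyadic_interval L k \<longleftrightarrow> x * 2 ^ L \<le> 1"
      using x True by (simp add: dyadic_interval_def pw field_simps)
    also have "\<dots> \<longleftrightarrow> \<lceil>x * 2 ^ L\<rceil> \<le> 1" by (simp add: ceiling_le_iff)
    also have "\<dots> \<longleftrightarrow> k = dyadic_index L x" unfolding True dyadic_index_def by auto
    finally show ?thesis .
  next
    case False
    have "x \<in> dyadic_interval L k \<longleftrightarrow> real k < x * 2 ^ L \<and> x * 2 ^ L \<le> real k + 1"
      using False by (simp add: dyadic_interval_def pw field_simps)
    also have "\<dots> \<longleftrightarrow> \<lceil>x * 2 ^ L\<rceil> = int k + 1" by (auto simp: ceiling_eq_iff)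
    also have "\<dots> \<longleftrightarrow> k = dyadic_index L x" unfolding dyadic_index_def using False c0 by auto
    finally show ?thesis .
  qed
qed

lemma histogram_eq:
  assumes "x \<in> {0..1}"
  shows "histogram L w x = 2 ^ L * w (dyadic_index L x)"
proof -
  have "(\<Sum>k<2 ^ L. w k * indicator (dyadic_interval L k) x)
      = (\<Sum>k<2 ^ L. if k = dyadic_index L x then w k else 0)"
    by (rule sum.cong) (auto simp: indicator_def mem_dyadic_interval_iff[OF assms])
  also have "\<dots> = w (dyadic_index L x)"
    using dyadic_index_less[OF assms] by simp
  finally show ?thesis by (simp add: histogram_def)
qed

section \<open>The likelihood in terms of the bin counts\<close>

definition bin_count :: "nat \<Rightarrow> nat \<Rightarrow> (nat \<Rightarrow> real) \<Rightarrow> nat \<Rightarrow> nat" where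
  "bin_count L n xs k = card {i\<in>{..<n}. xs i \<in> dyadic_interval L k}"

lemma bin_count_eq:
  assumes "\<And>i. i < n \<Longrightarrow> xs i \<in> {0..1}"
  shows "bin_count L n xs k = card {i\<in>{..<n}. dyadic_index L (xs i) = k}"
proof -
  have "xs i \<in> dyadic_interval L k \<longleftrightarrow> k = dyadic_index L (xs i)" if "i < n" for i
    by (rule mem_dyadic_interval_iff[OF assms[OF that]])
  then show ?thesis unfolding bin_count_def by (intro arg_cong[where f = card]) auto
qed

lemma sum_bin_count:
  assumes "\<And>i. i < n \<Longrightarrow> xs i \<in> {0..1}"
  shows "(\<Sum>k<2 ^ L. bin_count L n xs k) = n"
proof -
  have "(\<Sum>k<2 ^ L. bin_count L n xs k) = (\<Sum>k<2 ^ L. \<Sum>i\<in>{i\<in>{..<n}. dyadic_index L (xs i) = k}. 1)"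
    by (simp add: bin_count_eq[OF assms])
  also have "\<dots> = (\<Sum>i<n. 1)"
    by (rule sum.group) (use assms dyadic_index_less in auto)
  finally show ?thesis by simp
qed

text \<open>Grouping the observations by bin turns the likelihood into a monomial in the weights;
  this is what makes the Dirichlet prior conjugate.\<close>

lemma prod_histogram:
  assumes "\<And>i. i < n \<Longrightarrow> xs i \<in> {0..1}"
  shows "(\<Prod>i<n. histogram L w (xs i)) = (2 ^ L) ^ n * (\<Prod>k<2 ^ L. w k ^ bin_count L n xs k)"
proof -
  have "(\<Prod>i<n. histogram L w (xs i)) = (\<Prod>i<n. 2 ^ L * w (dyadic_index L (xs i)))"
    by (intro prod.cong refl histogram_eq) (use assms in auto)
  also have "\<dots> = (2 ^ L) ^ n * (\<Prod>i<n. w (dyadic_index L (xs i)))"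
    by (simp add: prod.distrib)
  also have "(\<Prod>i<n. w (dyadic_index L (xs i)))
      = (\<Prod>k<2 ^ L. \<Prod>i\<in>{i\<in>{..<n}. dyadic_index L (xs i) = k}. w (dyadic_index L (xs i)))"
    by (rule prod.group[symmetric]) (use assms dyadic_index_less in auto)
  also have "\<dots> = (\<Prod>k<2 ^ L. w k ^ bin_count L n xs k)"
  proof (rule prod.cong[OF refl])
    fix k :: nat
    show "(\<Prod>i\<in>{i\<in>{..<n}. dyadic_index L (xs i) = k}. w (dyadic_index L (xs i)))
      = w k ^ bin_count L n xs k"
      by (simp add: bin_count_eq[OF assms])
  qed
  finally show ?thesis .
qed

lemma hist_posterior_le_1: "hist_posterior L a n xs B \<le> 1"
proof -
  let ?num = "\<integral>\<^sup>+ w. indicator B (histogram L w) * ennreal (\<Prod>i<n. histogram L w (xs i)) \<partial>dirichlet (2 ^ L) a"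
  let ?den = "\<integral>\<^sup>+ w. ennreal (\<Prod>i<n. histogram L w (xs i)) \<partial>dirichlet (2 ^ L) a"
  have "?num \<le> ?den" by (intro nn_integral_mono) (auto simp: indicator_def)
  then have "?num / ?den \<le> ?den / ?den" by (rule divide_right_mono_ennreal)
  \<comment> \<open>In \<open>ennreal\<close> the degenerate quotients 0/0 and infinity/infinity
    both equal 0.\<close>
  also have "\<dots> \<le> 1"
    by (cases "?den = 0 \<or> ?den = \<infinity>") (auto simp: ennreal_divide_self top.not_eq_extremum)
  finally show ?thesis unfolding hist_posterior_def .
qed

text \<open>If the histogram lies in B, some weight is more than t away from \<open>p k\<close>. A
  union bound over k and Markov's inequality for the powers m and -m of the weight bound the
  posterior mass. The posterior is Dirichlet with parameters A, and the two products are its moments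
  of order m and -m.\<close>

lemma hist_posterior_le_sum:
  fixes a p :: "nat \<Rightarrow> real" and t :: real
  assumes a: "\<And>k. k < 2 ^ L \<Longrightarrow> 0 < a k"
    and xs: "\<And>i. i < n \<Longrightarrow> xs i \<in> {0..1}"
    and t: "0 \<le> t" "\<And>k. k < 2 ^ L \<Longrightarrow> t < p k"
    and B: "\<And>w. \<forall>k<2 ^ L. \<bar>w k - p k\<bar> \<le> t \<Longrightarrow> histogram L w \<notin> B"
    and A_def: "\<And>k. A k = a k + real (bin_count L n xs k)"
    and m: "\<And>k. k < 2 ^ L \<Longrightarrow> real m < A k"
  shows "hist_posterior L a n xs B \<le> ennreal (\<Sum>k<2 ^ L.
      (\<Prod>j<m. (A k + real j) / ((\<Sum>i<2 ^ L. A i) + real j)) / (p k + t) ^ m +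
      (p k - t) ^ m * (\<Prod>j<m. ((\<Sum>i<2 ^ L. A i) - real m + real j) / (A k - real m + real j)))"
proof -
  let ?K = "2 ^ L :: nat"
  define N where "N = (\<lambda>k. real (bin_count L n xs k))"
  \<comment> \<open>\<open>G c\<close> is the monomial with exponents c and \<open>F c\<close> its
    prior moment. The exponents \<open>up k\<close> and \<open>dn k\<close> are those of the
    likelihood multiplied and divided by the m-th power of \<open>w k\<close>.\<close>
  define G where "G = (\<lambda>(c :: nat \<Rightarrow> real) w. \<Prod>k<?K. w k powr c k)"
  define C :: real where "C = (2 ^ L) ^ n"
  define up where "up = (\<lambda>k. N(k := N k + real m))"
  define dn where "dn = (\<lambda>k. N(k := N k - real m))"
  define F where "F = (\<lambda>c. multi_beta ?K (\<lambda>k. a k + c k) / multi_beta ?K a)"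
  have C: "0 < C" by (simp add: C_def)
  have A_eq: "A = (\<lambda>k. a k + N k)" by (auto simp: A_def N_def)
  have A_pos: "0 < A k" if "k < ?K" for k using a[OF that] by (simp add: A_def add_pos_nonneg)
  have pt: "0 < p k" "0 < p k + t" "0 < p k - t" if "k < ?K" for k using t(1) t(2)[OF that] by auto
  have mb: "0 < multi_beta ?K c" if "\<And>k. k < ?K \<Longrightarrow> 0 < c k" for c
    using multi_beta_pos[of "?K - 1" c] that by simp
  have G_meas [measurable]: "G c \<in> borel_measurable (dirichlet ?K a)" for c
    unfolding G_def by measurable
  have int_G: "(\<integral>\<^sup>+ w. ennreal (G c w) \<partial>dirichlet ?K a) = ennreal (F c)"
    if "\<And>k. k < ?K \<Longrightarrow> 0 < a k + c k" for c
    unfolding G_def F_def by (rule nn_integral_dirichlet_powr) (use a that in auto)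
  have F_nonneg: "0 \<le> F c" if "\<And>k. k < ?K \<Longrightarrow> 0 < a k + c k" for c
    unfolding F_def by (intro divide_nonneg_nonneg less_imp_le mb a that) auto
  have up_pos: "0 < a j + up k j" if "j < ?K" "k < ?K" for j k
    using A_pos[OF that(1)] by (auto simp: up_def A_eq)
  have dn_pos: "0 < a j + dn k j" if "j < ?K" "k < ?K" for j k
    using A_pos[OF that(1)] m[OF that(1)] by (auto simp: dn_def A_eq)
  have FN: "0 < F N" unfolding F_def using A_pos by (intro divide_pos_pos mb a) (auto simp: A_eq)

  have lik: "(\<Prod>i<n. histogram L w (xs i)) = C * G N w" if "\<forall>k<?K. 0 < w k" for w
  proof -
    have "(\<Prod>i<n. histogram L w (xs i)) = C * (\<Prod>k<2 ^ L. w k ^ bin_count L n xs k)"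
      unfolding C_def by (rule prod_histogram) (rule xs)
    also have "(\<Prod>k<2 ^ L. w k ^ bin_count L n xs k) = G N w"
      unfolding G_def N_def using that by (intro prod.cong refl) (auto simp: powr_realpow)
    finally show ?thesis .
  qed
  have G_upd: "G (N(k := N k + x)) w = w k powr x * G N w" if "k < ?K" for w k x
  proof -
    have "G (N(k := N k + x)) w = w k powr (N k + x) * (\<Prod>j\<in>{..<?K}-{k}. w j powr N j)"
      unfolding G_def using that by (subst prod.remove[of "{..<?K}" k]) auto
    moreover have "G N w = w k powr N k * (\<Prod>j\<in>{..<?K}-{k}. w j powr N j)"
      unfolding G_def using that by (subst prod.remove[of "{..<?K}" k]) auto
    ultimately show ?thesis by (simp add: powr_add)
  qed
  have G_up: "G (up k) w = w k ^ m * G N w" and G_dn: "G (dn k) w = G N w / w k ^ m"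
    if "k < ?K" "0 < w k" for k w
    using that G_upd[of k "real m" w] G_upd[of k "- real m" w]
    by (simp_all add: up_def dn_def powr_realpow powr_minus divide_inverse)
  have G_nonneg: "0 \<le> G c w" for c w unfolding G_def by (intro prod_nonneg) auto

  have den: "(\<integral>\<^sup>+ w. ennreal (\<Prod>i<n. histogram L w (xs i)) \<partial>dirichlet ?K a) = ennreal (C * F N)"
  proof -
    have "(\<integral>\<^sup>+ w. ennreal (\<Prod>i<n. histogram L w (xs i)) \<partial>dirichlet ?K a)
        = (\<integral>\<^sup>+ w. ennreal C * ennreal (G N w) \<partial>dirichlet ?K a)"
      using AE_dirichlet_pos[of ?K a] C
      by (intro nn_integral_cong_AE) (auto simp: lik ennreal_mult'[symmetric] elim!: eventually_mono)
    also have "\<dots> = ennreal C * ennreal (F N)"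
      using A_pos by (subst nn_integral_cmult) (auto simp: int_G A_eq)
    finally show ?thesis using C by (simp add: ennreal_mult'[symmetric])
  qed
  let ?S = "\<Sum>k<?K. F (up k) / (p k + t) ^ m + (p k - t) ^ m * F (dn k)"
  have num: "(\<integral>\<^sup>+ w. indicator B (histogram L w) * ennreal (\<Prod>i<n. histogram L w (xs i)) \<partial>dirichlet ?K a)
      \<le> ennreal (C * ?S)"
  proof -
    have "(\<integral>\<^sup>+ w. indicator B (histogram L w) * ennreal (\<Prod>i<n. histogram L w (xs i)) \<partial>dirichlet ?K a)
      \<le> (\<integral>\<^sup>+ w. (\<Sum>k<?K. ennreal (C * (1 / (p k + t) ^ m)) * ennreal (G (up k) w)
           + ennreal (C * (p k - t) ^ m) * ennreal (G (dn k) w)) \<partial>dirichlet ?K a)"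
    proof (rule nn_integral_mono_AE)
      show "AE w in dirichlet ?K a. indicator B (histogram L w) * ennreal (\<Prod>i<n. histogram L w (xs i))
         \<le> (\<Sum>k<?K. ennreal (C * (1 / (p k + t) ^ m)) * ennreal (G (up k) w)
           + ennreal (C * (p k - t) ^ m) * ennreal (G (dn k) w))"
        using AE_dirichlet_pos[of ?K a, simplified]
      proof eventually_elim
        case (elim w)
        show ?case
        proof (cases "histogram L w \<in> B")
          case True
          then obtain k where k: "k < ?K" "\<bar>w k - p k\<bar> > t" using B[of w] by force
          have wk: "0 < w k" using elim k by auto
          \<comment> \<open>Markov's inequality in pointwise form: one of the ratios of
            \<open>w k\<close> to \<open>p k + t\<close> and of \<open>p k - t\<close> to
            \<open>w k\<close> exceeds 1, so the likelihood may be multiplied by its m-th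
            power.\<close>
          have "C * G N w \<le> C * (1 / (p k + t) ^ m) * G (up k) w \<or>
                C * G N w \<le> C * (p k - t) ^ m * G (dn k) w"
          proof (cases "w k > p k + t")
            case True
            then have "1 \<le> (w k / (p k + t)) ^ m"
              using pt[OF k(1)] by (intro one_le_power) auto
            then have "C * G N w * 1 \<le> C * G N w * (w k / (p k + t)) ^ m"
              using C G_nonneg by (intro mult_left_mono) auto
            then show ?thesis using k wk by (simp add: G_up power_divide mult_ac)
          next
            case False
            then have "w k < p k - t" using k by auto
            then have "1 \<le> ((p k - t) / w k) ^ m"
              using wk by (intro one_le_power) auto
            then have "C * G N w * 1 \<le> C * G N w * ((p k - t) / w k) ^ m"
              using C G_nonneg by (intro mult_left_mono) auto
            then show ?thesis using k wk by (simp add: G_dn power_divide mult_ac)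
          qed
          then have "ennreal (C * G N w) \<le> ennreal (C * (1 / (p k + t) ^ m)) * ennreal (G (up k) w)
             + ennreal (C * (p k - t) ^ m) * ennreal (G (dn k) w)"
          proof
            assume "C * G N w \<le> C * (1 / (p k + t) ^ m) * G (up k) w"
            then have "ennreal (C * G N w) \<le> ennreal (C * (1 / (p k + t) ^ m)) * ennreal (G (up k) w)"
              using C pt[OF k(1)] G_nonneg by (subst ennreal_mult[symmetric]) (auto intro!: ennreal_leI)
            then show ?thesis by (rule order_trans) simp
          next
            assume "C * G N w \<le> C * (p k - t) ^ m * G (dn k) w"
            then have "ennreal (C * G N w) \<le> ennreal (C * (p k - t) ^ m) * ennreal (G (dn k) w)"
              using C pt[OF k(1)] G_nonneg by (subst ennreal_mult[symmetric]) (auto intro!: ennreal_leI)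
            then show ?thesis by (rule order_trans) simp
          qed
          also have "\<dots> \<le> (\<Sum>k<?K. ennreal (C * (1 / (p k + t) ^ m)) * ennreal (G (up k) w)
           + ennreal (C * (p k - t) ^ m) * ennreal (G (dn k) w))"
            using k(1) by (intro member_le_sum) auto
          finally show ?thesis using True elim by (simp add: lik)
        qed simp
      qed
    qed
    also have "\<dots> = (\<Sum>k<?K. ennreal (C * (1 / (p k + t) ^ m)) * ennreal (F (up k))
           + ennreal (C * (p k - t) ^ m) * ennreal (F (dn k)))"
      by (subst nn_integral_sum, measurable, intro sum.cong refl)
         (simp add: nn_integral_add nn_integral_cmult int_G up_pos dn_pos)
    also have "\<dots> = (\<Sum>k<?K. ennreal (C * (F (up k) / (p k + t) ^ m + (p k - t) ^ m * F (dn k))))"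
    proof (intro sum.cong refl)
      fix k assume "k \<in> {..<?K}"
      then have k: "k < ?K" by simp
      have "0 \<le> F (up k)" "0 \<le> F (dn k)" using k by (auto intro!: F_nonneg up_pos dn_pos)
      then show "ennreal (C * (1 / (p k + t) ^ m)) * ennreal (F (up k)) + ennreal (C * (p k - t) ^ m) * ennreal (F (dn k))
        = ennreal (C * (F (up k) / (p k + t) ^ m + (p k - t) ^ m * F (dn k)))"
        using C pt[OF k]
        by (simp add: ennreal_mult[symmetric] ennreal_plus[symmetric] algebra_simps del: ennreal_plus)
    qed
    also have "\<dots> = ennreal (C * ?S)"
    proof -
      have "0 \<le> C * (F (up k) / (p k + t) ^ m + (p k - t) ^ m * F (dn k))" if "k < ?K" for k
      proof -
        have "0 \<le> F (up k)" "0 \<le> F (dn k)" using that by (auto intro!: F_nonneg up_pos dn_pos)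
        then show ?thesis using C pt[OF that] by simp
      qed
      then show ?thesis by (subst sum_ennreal) (auto simp: sum_distrib_left)
    qed
    finally show ?thesis .
  qed
  have "hist_posterior L a n xs B \<le> ennreal (C * ?S) / ennreal (C * F N)"
    unfolding hist_posterior_def den by (rule divide_right_mono_ennreal[OF num])
  also have "\<dots> = ennreal (C * ?S / (C * F N))"
  proof (rule divide_ennreal)
    have "0 \<le> F (up k) / (p k + t) ^ m + (p k - t) ^ m * F (dn k)" if "k < ?K" for k
    proof -
      have "0 \<le> F (up k)" "0 \<le> F (dn k)" using that by (auto intro!: F_nonneg up_pos dn_pos)
      then show ?thesis using pt[OF that] by simp
    qed
    then show "0 \<le> C * ?S" using C by (intro mult_nonneg_nonneg sum_nonneg) auto
    show "0 < C * F N" using C FN by simp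
  qed
  also have "C * ?S / (C * F N) = ?S / F N" using C by simp
  also have "?S / F N = (\<Sum>k<?K. (F (up k) / F N) / (p k + t) ^ m + (p k - t) ^ m * (F (dn k) / F N))"
    unfolding sum_divide_distrib by (intro sum.cong refl) (simp add: add_divide_distrib field_simps)
  also have "\<dots> = (\<Sum>k<2 ^ L.
      (\<Prod>j<m. (A k + real j) / ((\<Sum>i<2 ^ L. A i) + real j)) / (p k + t) ^ m +
      (p k - t) ^ m * (\<Prod>j<m. ((\<Sum>i<2 ^ L. A i) - real m + real j) / (A k - real m + real j)))"
  proof (intro sum.cong refl)
    fix k assume "k \<in> {..<?K}"
    then have k: "k < ?K" by simp
    \<comment> \<open>The prior constant \<open>multi_beta ?K a\<close> cancels, so that only ratios
      at the posterior parameters A remain.\<close>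
    have rat: "F c / F N = multi_beta ?K (\<lambda>k. a k + c k) / multi_beta ?K A" for c
      using mb[of a] a by (simp add: F_def A_eq)
    have "(\<lambda>j. a j + up k j) = A(k := A k + real m)" "(\<lambda>j. a j + dn k j) = A(k := A k - real m)"
      by (auto simp: up_def dn_def A_eq)
    then show "(F (up k) / F N) / (p k + t) ^ m + (p k - t) ^ m * (F (dn k) / F N) =
      (\<Prod>j<m. (A k + real j) / ((\<Sum>i<2 ^ L. A i) + real j)) / (p k + t) ^ m +
      (p k - t) ^ m * (\<Prod>j<m. ((\<Sum>i<2 ^ L. A i) - real m + real j) / (A k - real m + real j))"
      unfolding rat
      using multi_beta_shift_up[where b = A, OF k A_pos] multi_beta_shift_down[where b = A, OF k A_pos m[OF k]]
      by simp
  qed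
  finally show ?thesis .
qed

section \<open>Exponential bounds\<close>

lemma exp_le_one_plus_square:
  fixes x :: real
  assumes "\<bar>x\<bar> \<le> 1"
  shows "exp x \<le> 1 + x + x\<^sup>2"
proof (cases "0 \<le> x")
  case True
  then show ?thesis using assms exp_bound[of x] by auto
next
  case False
  define y where "y = - x"
  have y: "0 < y" using False by (simp add: y_def)
  have "exp x = inverse (exp y)" by (simp add: y_def exp_minus)
  also have "\<dots> \<le> inverse (1 + y)"
    using y exp_ge_add_one_self[of y] by (intro le_imp_inverse_le) auto
  also have "\<dots> \<le> 1 - y + y\<^sup>2"
  proof -
    \<comment> \<open>The right-hand side equals 1 + y^3.\<close>
    have "1 \<le> (1 - y + y\<^sup>2) * (1 + y)"
      using y by (simp add: algebra_simps power2_eq_square)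
    then show ?thesis using y by (simp add: field_simps)
  qed
  finally show ?thesis by (simp add: y_def)
qed

text \<open>Each factor is at most p + 3t/4 while Markov's inequality divides by p + t. The gap t/4,
  relative to p + t \<le> 2p, gains a factor 1 - t/(8p) for each of the m terms.\<close>

lemma upper_moment_ratio_le:
  fixes p t n A Ak :: real
  assumes t: "0 < t" "t \<le> p" and n: "0 < n" "n \<le> A" and Ak: "0 \<le> Ak" "Ak + real m \<le> n * (p + 3 / 4 * t)"
  shows "(\<Prod>j<m. (Ak + real j) / (A + real j)) / (p + t) ^ m \<le> exp (- (real m * t / (8 * p)))"
proof -
  have "(Ak + real j) / (A + real j) \<le> p + 3 / 4 * t" if "j < m" for j
  proof -
    have "(Ak + real j) / (A + real j) \<le> (n * (p + 3 / 4 * t)) / n"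
      using that t n Ak by (intro frac_le) auto
    then show ?thesis using n by simp
  qed
  then have "(\<Prod>j<m. (Ak + real j) / (A + real j)) \<le> (\<Prod>j<m. p + 3 / 4 * t)"
    using n Ak by (intro prod_mono) auto
  then have "(\<Prod>j<m. (Ak + real j) / (A + real j)) / (p + t) ^ m \<le> ((p + 3 / 4 * t) / (p + t)) ^ m"
    using t by (simp add: power_divide divide_right_mono)
  also have "\<dots> \<le> exp (- (t / (8 * p))) ^ m"
  proof (rule power_mono)
    have "(p + 3 / 4 * t) / (p + t) = 1 - (t / 4) / (p + t)" using t by (simp add: field_simps)
    also have "\<dots> \<le> 1 - (t / 4) / (2 * p)"
      using t by (intro diff_left_mono divide_left_mono) auto
    also have "\<dots> = 1 + (- (t / (8 * p)))" by simp
    also have "\<dots> \<le> exp (- (t / (8 * p)))" by (rule exp_ge_add_one_self)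
    finally show "(p + 3 / 4 * t) / (p + t) \<le> exp (- (t / (8 * p)))" .
  qed (use t in auto)
  also have "\<dots> = exp (- (real m * t / (8 * p)))"
    by (simp add: exp_of_nat_mult[symmetric])
  finally show ?thesis .
qed

text \<open>After multiplication by p - t each factor has numerator at most n (p - 7t/8) and
  denominator at least n (p - 5t/8). The gap is again t/4; comparing it with 2p is generous here but
  yields the same exponent as the upper bound.\<close>

lemma lower_moment_ratio_le:
  fixes p t n A Ak :: real
  assumes t: "0 < t" "t \<le> p" and n: "0 < n" and A: "real m \<le> A" "A * (p - t) \<le> n * (p - 7 / 8 * t)"
    and Ak: "n * (p - 5 / 8 * t) \<le> Ak - real m"
  shows "(p - t) ^ m * (\<Prod>j<m. (A - real m + real j) / (Ak - real m + real j))
    \<le> exp (- (real m * t / (8 * p)))"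
proof -
  have pos: "0 < n * (p - 5 / 8 * t)" using t n by (intro mult_pos_pos) auto
  have "(p - t) ^ m * (\<Prod>j<m. (A - real m + real j) / (Ak - real m + real j))
    = (\<Prod>j<m. (p - t) * ((A - real m + real j) / (Ak - real m + real j)))"
    by (simp add: prod.distrib del: times_divide_eq_right)
  also have "\<dots> \<le> (\<Prod>j<m. exp (- (t / (8 * p))))"
  proof (rule prod_mono, safe)
    fix j assume j: "j < m"
    show "0 \<le> (p - t) * ((A - real m + real j) / (Ak - real m + real j))"
      using t A Ak pos by auto
    have "(p - t) * ((A - real m + real j) / (Ak - real m + real j)) = (A - real m + real j) * (p - t) / (Ak - real m + real j)"
      by simp
    also have "\<dots> \<le> (n * (p - 7 / 8 * t)) / (n * (p - 5 / 8 * t))"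
    proof (rule frac_le)
      have "(A - real m + real j) * (p - t) \<le> A * (p - t)"
        using j t by (intro mult_right_mono) auto
      then show "(A - real m + real j) * (p - t) \<le> n * (p - 7 / 8 * t)" using A by simp
    qed (use pos Ak t n in auto)
    also have "\<dots> = 1 - (t / 4) / (p - 5 / 8 * t)" using t n by (simp add: field_simps)
    also have "\<dots> \<le> 1 - (t / 4) / (2 * p)"
      using t by (intro diff_left_mono divide_left_mono) auto
    also have "\<dots> = 1 + (- (t / (8 * p)))" by simp
    also have "\<dots> \<le> exp (- (t / (8 * p)))" by (rule exp_ge_add_one_self)
    finally show "(p - t) * ((A - real m + real j) / (Ak - real m + real j)) \<le> exp (- (t / (8 * p)))" .
  qed
  also have "\<dots> = exp (- (real m * t / (8 * p)))"
    by (simp add: exp_of_nat_mult[symmetric])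
  finally show ?thesis .
qed

lemma (in prob_space) nn_integral_exp_count_le:
  fixes s :: real
  assumes I [measurable]: "I \<in> sets M" and s: "\<bar>s\<bar> \<le> 1"
  shows "(\<integral>\<^sup>+ xs. ennreal (exp (s * real (card {i\<in>{..<n}. xs i \<in> I}))) \<partial>PiM {..<n} (\<lambda>_. M))
    \<le> ennreal (exp (real n * prob I * (s + s\<^sup>2)))"
proof -
  interpret product_sigma_finite "\<lambda>_::nat. M" by standard
  have eq: "ennreal (exp (s * real (card {i\<in>{..<n}. xs i \<in> I}))) = (\<Prod>i<n. ennreal (exp (s * indicator I (xs i))))" for xs
  proof -
    have "real (card {i\<in>{..<n}. xs i \<in> I}) = (\<Sum>i<n. indicator I (xs i))"
      by (simp add: indicator_def of_bool_def sum.If_cases Int_def)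
    then have "exp (s * real (card {i\<in>{..<n}. xs i \<in> I})) = (\<Prod>i<n. exp (s * indicator I (xs i)))"
      by (simp only: sum_distrib_left exp_sum[OF finite_lessThan])
    then show ?thesis by (simp add: prod_ennreal)
  qed
  have "(\<integral>\<^sup>+ x. ennreal (exp (s * indicator I x)) \<partial>M) = ennreal (exp s) * emeasure M I + emeasure M (space M - I)"
  proof -
    have "(\<integral>\<^sup>+ x. ennreal (exp (s * indicator I x)) \<partial>M)
      = (\<integral>\<^sup>+ x. ennreal (exp s) * indicator I x + indicator (space M - I) x \<partial>M)"
      by (intro nn_integral_cong) (auto simp: indicator_def)
    also have "\<dots> = ennreal (exp s) * emeasure M I + emeasure M (space M - I)"
      by (subst nn_integral_add) (auto simp: nn_integral_cmult_indicator)
    finally show ?thesis .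
  qed
  also have "\<dots> = ennreal (exp s * prob I + (1 - prob I))"
    by (simp add: emeasure_eq_measure prob_compl ennreal_mult'[symmetric] ennreal_plus[symmetric] del: ennreal_plus)
  also have "\<dots> \<le> ennreal (exp (prob I * (s + s\<^sup>2)))"
  proof (rule ennreal_leI)
    have "exp s * prob I + (1 - prob I) = 1 + prob I * (exp s - 1)" by (simp add: algebra_simps)
    also have "\<dots> \<le> 1 + prob I * (s + s\<^sup>2)"
      using exp_le_one_plus_square[OF s] by (intro add_left_mono mult_left_mono) auto
    also have "\<dots> \<le> exp (prob I * (s + s\<^sup>2))" by (rule exp_ge_add_one_self)
    finally show "exp s * prob I + (1 - prob I) \<le> exp (prob I * (s + s\<^sup>2))" .
  qed
  finally have one: "(\<integral>\<^sup>+ x. ennreal (exp (s * indicator I x)) \<partial>M) \<le> ennreal (exp (prob I * (s + s\<^sup>2)))" .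
  have "(\<integral>\<^sup>+ xs. ennreal (exp (s * real (card {i\<in>{..<n}. xs i \<in> I}))) \<partial>PiM {..<n} (\<lambda>_. M))
    = (\<Prod>i<n. \<integral>\<^sup>+ x. ennreal (exp (s * indicator I x)) \<partial>M)"
    unfolding eq by (subst product_nn_integral_prod) auto
  also have "\<dots> \<le> (\<Prod>i<n. ennreal (exp (prob I * (s + s\<^sup>2))))"
    by (simp add: power_mono_ennreal one)
  also have "\<dots> = ennreal (exp (real n * prob I * (s + s\<^sup>2)))"
    by (simp add: ennreal_power exp_of_nat_mult[symmetric] mult.assoc)
  finally show ?thesis .
qed

lemma measurable_bin_count:
  assumes "sets M = sets borel"
  shows "(\<lambda>xs. real (bin_count L n xs k)) \<in> borel_measurable (PiM {..<n} (\<lambda>_. M))"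
proof -
  have [measurable]: "dyadic_interval L k \<in> sets borel" by (auto simp: dyadic_interval_def)
  note assms[measurable_cong]
  have "real (bin_count L n xs k) = (\<Sum>i<n. indicator (dyadic_interval L k) (xs i))" for xs
    unfolding bin_count_def by (simp add: indicator_def of_bool_def sum.If_cases Int_def)
  then show ?thesis by simp
qed

text \<open>If every count is within nt/2 of its mean, the moment bounds make the posterior mass at
  most 2 exponentials per bin. Otherwise the trivial bound 1 is dominated by Chernoff exponentials,
  whose expectations add 2 more per bin. P bounds the individual bin masses, and D bounds P times
  the number of bins, which limits the influence of the total prior mass.\<close>

lemma nn_integral_hist_posterior_le:
  fixes M :: "real measure" and a :: "nat \<Rightarrow> real" and t c D P :: real and L n :: nat
  defines "p \<equiv> \<lambda>k. measure M (dyadic_interval L k)"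
  assumes M: "prob_space M" "sets M = sets borel" "AE x in M. x \<in> {0..1}"
    and a: "\<And>k. k < 2 ^ L \<Longrightarrow> 0 < a k \<and> a k \<le> c"
    and t: "0 < t" "\<And>k. k < 2 ^ L \<Longrightarrow> 2 * t \<le> p k"
    and P: "\<And>k. k < 2 ^ L \<Longrightarrow> p k \<le> P" "P * 2 ^ L \<le> D"
    and nt: "32 \<le> real n * t" "8 * c \<le> real n * t" "8 * (c * D) \<le> real n * t"
    and B: "\<And>w. \<forall>k<2 ^ L. \<bar>w k - p k\<bar> \<le> t \<Longrightarrow> histogram L w \<notin> B"
  shows "(\<integral>\<^sup>+ xs. hist_posterior L a n xs B \<partial>PiM {..<n} (\<lambda>_. M))
    \<le> ennreal (4 * 2 ^ L * exp (- (real n * t\<^sup>2 / (256 * P))))"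
proof -
  interpret prob_space M by fact
  interpret PM: prob_space "PiM {..<n} (\<lambda>_. M)" by (intro prob_space_PiM M)
  let ?K = "2 ^ L :: nat"
  let ?e = "exp (- (real n * t\<^sup>2 / (256 * P)))"
  have I [measurable]: "dyadic_interval L k \<in> sets M" for k
    unfolding M by (auto simp: dyadic_interval_def)
  note M(2)[measurable_cong]
  have n: "0 < real n" using nt(1) by (cases n) auto
  have pk: "0 < p k" if "k < ?K" for k using t(1) t(2)[OF that] by linarith
  have tp: "t \<le> p k" "t < p k" if "k < ?K" for k using t(1) t(2)[OF that] by linarith+
  have c: "0 < c" using a[of 0] by auto
  have P_pos: "0 < P" using pk[of 0] P(1)[of 0] by auto
  \<comment> \<open>This s minimises the Chernoff exponent n p s^2 - s n t/2, whose minimum is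
    computed in \<open>expo\<close>.\<close>
  define s where "s = (\<lambda>k. t / (4 * p k))"
  have s: "0 < s k" "s k \<le> 1" if "k < ?K" for k
    using tp[OF that] t(1) pk[OF that] by (auto simp: s_def field_simps)
  define N where "N = (\<lambda>xs k. real (bin_count L n xs k))"
  have [measurable]: "(\<lambda>xs. N xs k) \<in> borel_measurable (PiM {..<n} (\<lambda>_. M))" for k
    unfolding N_def by (rule measurable_bin_count[OF M(2)])
  \<comment> \<open>\<open>U k\<close> and \<open>V k\<close> are the exponential majorants of the
    events that the k-th count exceeds, or falls below, its mean by more than nt/2.\<close>
  define U where "U = (\<lambda>k xs. ennreal (exp (- (s k * (real n * p k + real n * t / 2)))) * ennreal (exp (s k * N xs k)))"
  define V where "V = (\<lambda>k xs. ennreal (exp (s k * (real n * p k - real n * t / 2))) * ennreal (exp (- s k * N xs k)))"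
  have [measurable]: "U k \<in> borel_measurable (PiM {..<n} (\<lambda>_. M))" "V k \<in> borel_measurable (PiM {..<n} (\<lambda>_. M))" for k
    unfolding U_def V_def by measurable
  \<comment> \<open>Counts give the constant 16 in the exponent and posterior moments give 256 = 32
    * 8; the weaker 256 serves for both, with P replacing the individual \<open>p k\<close>.\<close>
  have e_mono: "exp (- (real n * t\<^sup>2 / (C * p k))) \<le> ?e" if "k < ?K" "C \<le> 256" "0 < C" for k C
  proof -
    have "C * p k \<le> 256 * P" using P(1)[OF that(1)] that pk[OF that(1)] by (intro mult_mono) auto
    then have "real n * t\<^sup>2 / (256 * P) \<le> real n * t\<^sup>2 / (C * p k)"
      using pk[OF that(1)] that P_pos by (intro divide_left_mono) auto
    then show ?thesis by simp
  qed
  have expo: "real n * p k * (s k)\<^sup>2 - s k * (real n * t / 2) = - (real n * t\<^sup>2 / (16 * p k))" if "k < ?K" for k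
    using pk[OF that] by (simp add: s_def field_simps power2_eq_square)

  \<comment> \<open>Chernoff bounds for the bin counts\<close>
  have intU: "(\<integral>\<^sup>+ xs. U k xs \<partial>PiM {..<n} (\<lambda>_. M)) \<le> ennreal ?e" if k: "k < ?K" for k
  proof -
    have "(\<integral>\<^sup>+ xs. U k xs \<partial>PiM {..<n} (\<lambda>_. M)) = ennreal (exp (- (s k * (real n * p k + real n * t / 2)))) *
        (\<integral>\<^sup>+ xs. ennreal (exp (s k * N xs k)) \<partial>PiM {..<n} (\<lambda>_. M))"
      unfolding U_def by (subst nn_integral_cmult) auto
    also have "\<dots> \<le> ennreal (exp (- (s k * (real n * p k + real n * t / 2)))) *
        ennreal (exp (real n * p k * (s k + (s k)\<^sup>2)))"
      unfolding N_def bin_count_def p_def using s[OF k]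
      by (intro mult_left_mono nn_integral_exp_count_le) auto
    also have "\<dots> = ennreal (exp (real n * p k * (s k)\<^sup>2 - s k * (real n * t / 2)))"
      by (simp add: ennreal_mult[symmetric] exp_add[symmetric] algebra_simps)
    also have "\<dots> \<le> ennreal ?e"
      unfolding expo[OF k] by (intro ennreal_leI e_mono k) auto
    finally show ?thesis .
  qed
  have intV: "(\<integral>\<^sup>+ xs. V k xs \<partial>PiM {..<n} (\<lambda>_. M)) \<le> ennreal ?e" if k: "k < ?K" for k
  proof -
    have "(\<integral>\<^sup>+ xs. V k xs \<partial>PiM {..<n} (\<lambda>_. M)) = ennreal (exp (s k * (real n * p k - real n * t / 2))) *
        (\<integral>\<^sup>+ xs. ennreal (exp (- s k * N xs k)) \<partial>PiM {..<n} (\<lambda>_. M))"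
      unfolding V_def by (subst nn_integral_cmult) auto
    also have "\<dots> \<le> ennreal (exp (s k * (real n * p k - real n * t / 2))) *
        ennreal (exp (real n * p k * (- s k + (- s k)\<^sup>2)))"
      unfolding N_def bin_count_def p_def using s[OF k]
      by (intro mult_left_mono nn_integral_exp_count_le) auto
    also have "\<dots> = ennreal (exp (real n * p k * (s k)\<^sup>2 - s k * (real n * t / 2)))"
      by (simp add: ennreal_mult[symmetric] exp_add[symmetric] algebra_simps)
    also have "\<dots> \<le> ennreal ?e"
      unfolding expo[OF k] by (intro ennreal_leI e_mono k) auto
    finally show ?thesis .
  qed

  \<comment> \<open>Since nt/16 is at least 2, rounding down loses at most half of it.\<close>
  define m where "m = nat \<lfloor>real n * t / 16\<rfloor>"
  have m: "real m \<le> real n * t / 16" "real n * t / 32 \<le> real m"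
    using nt(1) unfolding m_def by linarith+
  have em: "exp (- (real m * t / (8 * p k))) \<le> ?e" if k: "k < ?K" for k
  proof -
    have "real n * t\<^sup>2 / (256 * p k) = (real n * t / 32) * t / (8 * p k)"
      by (simp add: power2_eq_square)
    also have "\<dots> \<le> real m * t / (8 * p k)"
      using m(2) t(1) pk[OF k] by (intro divide_right_mono mult_right_mono) auto
    finally show ?thesis using e_mono[OF k, of 256] by (auto intro: order_trans[rotated])
  qed

  \<comment> \<open>Posterior mass for typical counts\<close>
  have good: "hist_posterior L a n xs B \<le> ennreal (2 * 2 ^ L * ?e)"
    if xs: "\<And>i. i < n \<Longrightarrow> xs i \<in> {0..1}"
      and dev: "\<And>k. k < ?K \<Longrightarrow> \<bar>N xs k - real n * p k\<bar> \<le> real n * t / 2" for xs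
  proof -
    define A where "A = (\<lambda>k. a k + N xs k)"
    define S where "S = (\<Sum>i<?K. A i)"
    have "(\<Sum>i<?K. N xs i) = real (\<Sum>k<2 ^ L. bin_count L n xs k)" by (simp add: N_def)
    also have "\<dots> = real n" using sum_bin_count[of n xs L] xs by simp
    finally have SN: "S = (\<Sum>i<?K. a i) + real n" by (simp add: S_def A_def sum.distrib)
    have S1: "real n \<le> S" using a sum_nonneg[of "{..<?K}" a] by (force simp: SN)
    have "(\<Sum>i<?K. a i) \<le> (\<Sum>i<?K. c)" using a by (intro sum_mono) auto
    then have S2: "S \<le> 2 ^ L * c + real n" by (simp add: SN)
    have nt_pos: "0 < real n * t" using n t(1) by simp
    \<comment> \<open>The budget in units of nt: 1/2 from the count, 1/8 from the prior parameter
      and 1/16 from m, together below 3/4. In \<open>Alb\<close> the prior parameter only helps, and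
      1/2 + 1/16 is below 5/8.\<close>
    have Aub: "A k + real m \<le> real n * (p k + 3 / 4 * t)" if k: "k < ?K" for k
    proof -
      have "real n * (p k + 3 / 4 * t) = real n * p k + 3 / 4 * (real n * t)" by (simp add: algebra_simps)
      then show ?thesis using dev[OF k] a[OF k] m(1) nt(2) unfolding A_def by linarith
    qed
    have Alb: "real n * (p k - 5 / 8 * t) \<le> A k - real m" if k: "k < ?K" for k
    proof -
      have "real n * (p k - 5 / 8 * t) = real n * p k - 5 / 8 * (real n * t)" by (simp add: algebra_simps)
      then show ?thesis using dev[OF k] a[OF k] m(1) nt_pos unfolding A_def by linarith
    qed
    have mA: "real m < A k" if k: "k < ?K" for k
    proof -
      have "0 < real n * (p k - 5 / 8 * t)" using n tp[OF k] t(1) by (intro mult_pos_pos) auto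
      then show ?thesis using Alb[OF k] by linarith
    qed
    \<comment> \<open>The prior contributes at most \<open>2 ^ L * c\<close> to S; times a bin mass
      this is at most c D, hence at most nt/8, which turns p - t into p - 7t/8.\<close>
    have Sb: "S * (p k - t) \<le> real n * (p k - 7 / 8 * t)" if k: "k < ?K" for k
    proof -
      have "S * (p k - t) \<le> (2 ^ L * c + real n) * (p k - t)"
        using S2 tp[OF k] by (intro mult_right_mono) auto
      also have "\<dots> = 2 ^ L * c * (p k - t) + real n * (p k - t)" by (simp add: algebra_simps)
      also have "2 ^ L * c * (p k - t) \<le> 2 ^ L * c * P"
        using c P(1)[OF k] t(1) by (intro mult_left_mono) auto
      also have "\<dots> = c * (P * 2 ^ L)" by simp
      also have "\<dots> \<le> c * D" using P(2) c by (intro mult_left_mono) auto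
      also have "\<dots> \<le> real n * t / 8" using nt(3) by simp
      finally show ?thesis by (simp add: algebra_simps)
    qed
    have mS: "real m \<le> S"
    proof -
      have "0 \<le> A i" if "i < ?K" for i using mA[OF that] by linarith
      then have "A 0 \<le> S" unfolding S_def by (intro member_le_sum) auto
      then show ?thesis using mA[of 0] by simp
    qed
    have "hist_posterior L a n xs B \<le> ennreal (\<Sum>k<2 ^ L.
      (\<Prod>j<m. (A k + real j) / (S + real j)) / (p k + t) ^ m +
      (p k - t) ^ m * (\<Prod>j<m. (S - real m + real j) / (A k - real m + real j)))"
      unfolding S_def
      by (rule hist_posterior_le_sum) (use a xs t(1) tp B mA in \<open>auto simp: A_def N_def\<close>)
    also have "\<dots> \<le> ennreal (\<Sum>k<?K. ?e + ?e)"
    proof (intro ennreal_leI sum_mono add_mono)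
      fix k assume "k \<in> {..<?K}"
      then have k: "k < ?K" by simp
      have "0 \<le> A k" using mA[OF k] by linarith
      then have "(\<Prod>j<m. (A k + real j) / (S + real j)) / (p k + t) ^ m \<le> exp (- (real m * t / (8 * p k)))"
        using t(1) tp[OF k] n S1 Aub[OF k] by (intro upper_moment_ratio_le) auto
      then show "(\<Prod>j<m. (A k + real j) / (S + real j)) / (p k + t) ^ m \<le> ?e" using em[OF k] by linarith
      have "(p k - t) ^ m * (\<Prod>j<m. (S - real m + real j) / (A k - real m + real j)) \<le> exp (- (real m * t / (8 * p k)))"
        using t(1) tp[OF k] n mS Sb[OF k] Alb[OF k] by (intro lower_moment_ratio_le) auto
      then show "(p k - t) ^ m * (\<Prod>j<m. (S - real m + real j) / (A k - real m + real j)) \<le> ?e" using em[OF k] by linarith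
    qed
    also have "(\<Sum>k<?K. ?e + ?e) = 2 * 2 ^ L * ?e" by simp
    finally show ?thesis .
  qed

  \<comment> \<open>Integration over all samples\<close>
  have AE_unit: "AE xs in PiM {..<n} (\<lambda>_. M). \<forall>i\<in>{..<n}. xs i \<in> {0..1}"
  proof (rule AE_finite_allI)
    fix i assume "i \<in> {..<n}"
    then show "AE xs in PiM {..<n} (\<lambda>_. M). xs i \<in> {0..1}"
      using M by (intro AE_PiM_component) auto
  qed simp
  have "(\<integral>\<^sup>+ xs. hist_posterior L a n xs B \<partial>PiM {..<n} (\<lambda>_. M))
    \<le> (\<integral>\<^sup>+ xs. (\<Sum>k<?K. U k xs + V k xs) + ennreal (2 * 2 ^ L * ?e) \<partial>PiM {..<n} (\<lambda>_. M))"
  proof (rule nn_integral_mono_AE, use AE_unit in eventually_elim)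
    case (elim xs)
    show ?case
    proof (cases "\<forall>k<?K. \<bar>N xs k - real n * p k\<bar> \<le> real n * t / 2")
      case True
      then have "hist_posterior L a n xs B \<le> ennreal (2 * 2 ^ L * ?e)" using elim by (intro good) auto
      then show ?thesis by (rule order_trans) simp
    next
      case False
      then obtain k where k: "k < ?K" "\<bar>N xs k - real n * p k\<bar> > real n * t / 2" by (auto simp: not_le)
      have U_eq: "U k xs = ennreal (exp (s k * (N xs k - real n * p k - real n * t / 2)))"
        by (simp add: U_def ennreal_mult[symmetric] exp_add[symmetric] algebra_simps)
      have V_eq: "V k xs = ennreal (exp (s k * (real n * p k - N xs k - real n * t / 2)))"
        by (simp add: V_def ennreal_mult[symmetric] exp_add[symmetric] algebra_simps)
      \<comment> \<open>The k-th count is atypical, so one of the two exponents is nonnegative and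
        the majorants already dominate the trivial bound on the posterior.\<close>
      have "1 \<le> U k xs + V k xs"
      proof (cases "N xs k > real n * p k")
        case True
        then have "0 \<le> s k * (N xs k - real n * p k - real n * t / 2)" using k s[OF k(1)] by (intro mult_nonneg_nonneg) auto
        then have "1 \<le> U k xs" unfolding U_eq by (simp del: times_divide_eq_right)
        then show ?thesis by (rule order_trans) simp
      next
        case False
        then have "0 \<le> s k * (real n * p k - N xs k - real n * t / 2)" using k s[OF k(1)] by (intro mult_nonneg_nonneg) auto
        then have "1 \<le> V k xs" unfolding V_eq by (simp del: times_divide_eq_right)
        then show ?thesis by (rule order_trans) simp
      qed
      also have "\<dots> \<le> (\<Sum>k<?K. U k xs + V k xs)" using k by (intro member_le_sum) auto
      also have "\<dots> \<le> (\<Sum>k<?K. U k xs + V k xs) + ennreal (2 * 2 ^ L * ?e)" by simp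
      finally show ?thesis using hist_posterior_le_1 order_trans by blast
    qed
  qed
  also have "\<dots> = (\<Sum>k<?K. (\<integral>\<^sup>+ xs. U k xs \<partial>PiM {..<n} (\<lambda>_. M)) + (\<integral>\<^sup>+ xs. V k xs \<partial>PiM {..<n} (\<lambda>_. M)))
      + ennreal (2 * 2 ^ L * ?e)"
    by (simp add: nn_integral_add nn_integral_sum PM.emeasure_space_1)
  also have "\<dots> \<le> (\<Sum>k<?K. ennreal ?e + ennreal ?e) + ennreal (2 * 2 ^ L * ?e)"
    by (intro add_right_mono sum_mono add_mono) (auto intro: intU intV)
  also have "\<dots> = ennreal (4 * 2 ^ L * ?e)"
  proof -
    have "(\<Sum>k<?K. ennreal ?e + ennreal ?e) = ennreal (2 * 2 ^ L * ?e)"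
      by (simp add: ennreal_plus[symmetric] sum_ennreal mult_ac del: ennreal_plus sum_constant) (simp add: mult_ac)
    then show ?thesis by (simp add: ennreal_plus[symmetric] del: ennreal_plus)
  qed
  finally show ?thesis .
qed

section \<open>Bias and contraction rate\<close>

text \<open>Supplies the measurability of the density, which is not assumed separately.\<close>

lemma holder01_imp_continuous_on:
  assumes "holder01 \<alpha> g" "0 < \<alpha>"
  shows "continuous_on {0..1} g"
  unfolding continuous_on_def
proof
  fix x :: real assume x: "x \<in> {0..1}"
  obtain C where C: "\<And>x y. x \<in> {0..1} \<Longrightarrow> y \<in> {0..1} \<Longrightarrow> \<bar>g x - g y\<bar> \<le> C * \<bar>x - y\<bar> powr \<alpha>"
    using assms(1) unfolding holder01_def by blast
  have "((\<lambda>y. C * \<bar>y - x\<bar> powr \<alpha>) \<longlongrightarrow> C * 0) (at x within {0..1})"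
  proof (intro tendsto_mult_left tendsto_zero_powrI)
    show "((\<lambda>y. \<bar>y - x\<bar>) \<longlongrightarrow> 0) (at x within {0..1})"
      by (auto intro!: tendsto_eq_intros)
  qed (use assms in auto)
  then have "((\<lambda>y. C * \<bar>y - x\<bar> powr \<alpha>) \<longlongrightarrow> 0) (at x within {0..1})" by simp
  moreover have "\<forall>\<^sub>F y in at x within {0..1}. norm (g y - g x) \<le> C * \<bar>y - x\<bar> powr \<alpha>"
    unfolding eventually_at_filter using C[OF _ x] by (auto intro!: always_eventually)
  ultimately have "((\<lambda>y. g y - g x) \<longlongrightarrow> 0) (at x within {0..1})"
    by (rule Lim_null_comparison[rotated])
  then show "(g \<longlongrightarrow> g x) (at x within {0..1})" by (rule LIM_zero_cancel)
qed

text \<open>Serves twice for the mass of a bin: with the global bounds on the density, and with the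
  bounds that the Hoelder condition gives around a point of the bin.\<close>

lemma measure_density_bounds:
  fixes f :: "real \<Rightarrow> real"
  assumes f [measurable]: "(\<lambda>x. f x * indicator S x) \<in> borel_measurable borel"
    and I [measurable]: "I \<in> sets borel" and "I \<subseteq> S" and l: "emeasure lborel I = ennreal l" "0 \<le> l"
    and f_bounds: "\<And>y. y \<in> I \<Longrightarrow> lo \<le> f y \<and> f y \<le> hi" and lo: "0 \<le> lo" "lo \<le> hi"
  shows "lo * l \<le> measure (density lborel (\<lambda>x. ennreal (f x * indicator S x))) I"
    and "measure (density lborel (\<lambda>x. ennreal (f x * indicator S x))) I \<le> hi * l"
proof -
  let ?Q = "density lborel (\<lambda>x. ennreal (f x * indicator S x))"
  have eq: "emeasure ?Q I = (\<integral>\<^sup>+ x. ennreal (f x * indicator S x) * indicator I x \<partial>lborel)"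
    by (rule emeasure_density) auto
  have "(\<integral>\<^sup>+ x. ennreal lo * indicator I x \<partial>lborel) \<le> emeasure ?Q I"
    unfolding eq using f_bounds \<open>I \<subseteq> S\<close>
    by (intro nn_integral_mono) (auto simp: indicator_def intro!: ennreal_leI)
  then have 1: "ennreal (lo * l) \<le> emeasure ?Q I"
    using l lo by (simp add: nn_integral_cmult_indicator ennreal_mult[symmetric])
  have "emeasure ?Q I \<le> (\<integral>\<^sup>+ x. ennreal hi * indicator I x \<partial>lborel)"
    unfolding eq using f_bounds \<open>I \<subseteq> S\<close>
    by (intro nn_integral_mono) (auto simp: indicator_def intro!: ennreal_leI)
  then have 2: "emeasure ?Q I \<le> ennreal (hi * l)"
    using l lo by (simp add: nn_integral_cmult_indicator ennreal_mult[symmetric])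
  then have "emeasure ?Q I \<noteq> top" by (auto simp: top_unique)
  then have 3: "emeasure ?Q I = ennreal (measure ?Q I)" by (rule emeasure_eq_ennreal_measure) 
  show "lo * l \<le> measure ?Q I" using 1 unfolding 3 by simp
  show "measure ?Q I \<le> hi * l" using 2 lo l unfolding 3 by (simp add: ennreal_le_iff)
qed

lemma dyadic_interval_geometry:
  assumes "k < 2 ^ L"
  shows "dyadic_interval L k \<subseteq> {0..1}"
    and "emeasure lborel (dyadic_interval L k) = ennreal (1 / 2 ^ L)"
    and "\<And>x y. x \<in> dyadic_interval L k \<Longrightarrow> y \<in> dyadic_interval L k \<Longrightarrow> \<bar>x - y\<bar> \<le> 1 / 2 ^ L"
proof -
  have pw: "2 powr (- real L) = 1 / 2 ^ L"
    by (simp add: powr_minus powr_realpow divide_inverse)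
  have "real k + 1 \<le> 2 ^ L"
    using assms by (metis Suc_leI of_nat_Suc of_nat_le_iff of_nat_numeral of_nat_power add.commute)
  then have upper: "(real k + 1) / 2 ^ L \<le> 1" by simp
  show "dyadic_interval L k \<subseteq> {0..1}"
  proof
    fix x assume "x \<in> dyadic_interval L k"
    then have "real k / 2 ^ L \<le> x" "x \<le> (real k + 1) / 2 ^ L"
      by (auto simp: dyadic_interval_def pw split: if_splits)
    moreover have "0 \<le> real k / 2 ^ L" by simp
    ultimately show "x \<in> {0..1}" using upper unfolding atLeastAtMost_iff by linarith
  qed
  show "emeasure lborel (dyadic_interval L k) = ennreal (1 / 2 ^ L)"
    unfolding dyadic_interval_def pw
    by (simp add: divide_right_mono diff_divide_distrib[symmetric])
  show "\<bar>x - y\<bar> \<le> 1 / 2 ^ L" if "x \<in> dyadic_interval L k" "y \<in> dyadic_interval L k" for x y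
    using that unfolding dyadic_interval_def pw by (auto simp: add_divide_distrib distrib_right split: if_splits)
qed

text \<open>In terms of H the rate is \<epsilon> = H^\<alpha>, and the choice of H amounts to n
  \<epsilon>^2 H = ln n, which balances bias and stochastic error. Rounding L down keeps the bin
  width between H and 2 H, so all four bounds follow up to the factor 2.\<close>

lemma bandwidth_bounds:
  fixes \<alpha> H :: real and n L :: nat
  assumes \<alpha>: "0 < \<alpha>" "\<alpha> \<le> 1" and n: "1 \<le> ln (real n)"
    and H: "H = (real n / ln (real n)) powr (- 1 / (2 * \<alpha> + 1))"
    and L: "L = nat \<lfloor>log 2 (1 / H)\<rfloor>"
  defines "\<epsilon> \<equiv> (ln (real n) / real n) powr (\<alpha> / (2 * \<alpha> + 1))"
  shows "2 ^ L \<le> real n"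
    and "(1 / 2 ^ L) powr \<alpha> \<le> 2 * \<epsilon>"
    and "ln (real n) \<le> real n * \<epsilon> * (1 / 2 ^ L)"
    and "ln (real n) \<le> real n * \<epsilon>\<^sup>2 * (1 / 2 ^ L)"
proof -
  have n0: "0 < real n" using n by (cases n) auto
  define r where "r = ln (real n) / real n"
  have r: "0 < r" "r < 1" using n n0 ln_less_self[OF n0] by (auto simp: r_def)
  have H_eq: "H = r powr (1 / (2 * \<alpha> + 1))"
  proof -
    have "real n / ln (real n) = inverse r" by (simp add: r_def)
    then show ?thesis unfolding H using r
      by (simp add: powr_minus powr_divide inverse_eq_divide minus_divide_left[symmetric])
  qed
  have H01: "0 < H" "H \<le> 1" using r \<alpha> unfolding H_eq by (auto intro!: powr_le1)
  have eps: "\<epsilon> = H powr \<alpha>" unfolding \<epsilon>_def r_def[symmetric] H_eq powr_powr by simp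
  have "H powr (2 * \<alpha> + 1) = r" unfolding H_eq powr_powr using r \<alpha> by simp
  then have nH: "real n * H powr (2 * \<alpha> + 1) = ln (real n)" using n0 by (simp add: r_def)
  \<comment> \<open>Nonnegativity ensures that \<open>nat\<close> in the definition of L truncates
    nothing.\<close>
  have lg: "0 \<le> log 2 (1 / H)" using H01 by simp
  have "real L \<le> log 2 (1 / H)" "log 2 (1 / H) < real L + 1" unfolding L using lg by linarith+
  then have "2 powr real L \<le> 1 / H" "1 / H < 2 powr (real L + 1)"
    using H01 by (auto simp: le_log_iff log_less_iff)
  then have L1: "2 ^ L \<le> 1 / H" and L2: "1 / H < 2 * 2 ^ L"
    by (auto simp: powr_realpow powr_add)
  have d: "H \<le> 1 / 2 ^ L" "1 / 2 ^ L \<le> 2 * H" using L1 L2 H01 by (auto simp: field_simps)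
  have "1 / H = (1 / r) powr (1 / (2 * \<alpha> + 1))" using r unfolding H_eq by (simp add: powr_divide)
  also have "\<dots> \<le> (1 / r) powr 1" using r \<alpha> by (intro powr_mono) auto
  also have "\<dots> \<le> real n" using n n0 r by (simp add: r_def field_simps)
  finally show "2 ^ L \<le> real n" using L1 by linarith
  have "(1 / 2 ^ L) powr \<alpha> \<le> (2 * H) powr \<alpha>" using d \<alpha> by (intro powr_mono2) auto
  also have "\<dots> = 2 powr \<alpha> * \<epsilon>" using H01 by (simp add: powr_mult eps)
  also have "\<dots> \<le> 2 powr 1 * \<epsilon>" using \<alpha> by (intro mult_right_mono powr_mono) (auto simp: eps)
  finally show "(1 / 2 ^ L) powr \<alpha> \<le> 2 * \<epsilon>" by simp
  have sq: "\<epsilon>\<^sup>2 = H powr (2 * \<alpha>)" using H01 by (simp add: eps power2_eq_square powr_add[symmetric])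
  have "ln (real n) = real n * (\<epsilon>\<^sup>2 * H)" unfolding nH[symmetric] sq using H01 by (simp add: powr_add)
  also have "\<dots> \<le> real n * (\<epsilon>\<^sup>2 * (1 / 2 ^ L))" using d n0 by (intro mult_left_mono) auto
  finally show b: "ln (real n) \<le> real n * \<epsilon>\<^sup>2 * (1 / 2 ^ L)" by (simp add: mult.assoc)
  have "\<epsilon> \<le> 1" "0 \<le> \<epsilon>" unfolding eps using H01 \<alpha> by (auto intro!: powr_le1)
  then have "\<epsilon>\<^sup>2 \<le> \<epsilon>" by (simp add: power2_eq_square mult_left_le)
  then have "real n * \<epsilon>\<^sup>2 * (1 / 2 ^ L) \<le> real n * \<epsilon> * (1 / 2 ^ L)"
    by (intro mult_right_mono mult_left_mono) auto
  then show "ln (real n) \<le> real n * \<epsilon> * (1 / 2 ^ L)" using b by linarith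
qed

theorem theorem3:
  fixes \<alpha> \<rho>0 D0 a c1 c2 :: real
    and f0 :: "real \<Rightarrow> real"
    and \<alpha>p :: "nat \<Rightarrow> nat \<Rightarrow> real"
    and h :: "nat \<Rightarrow> real" and L :: "nat \<Rightarrow> nat"
  assumes alpha: "1/2 < \<alpha>" "\<alpha> \<le> 1"
    and dens: "(\<integral>\<^sup>+ x. ennreal (f0 x * indicator {0..1} x) \<partial>lborel) = 1"
    and bounds: "0 < \<rho>0" "\<And>x. x \<in> {0..1} \<Longrightarrow> \<rho>0 \<le> f0 x \<and> f0 x \<le> D0"
    and hol: "holder01 \<alpha> f0"
    and h_def: "\<And>n. h n = (real n / ln (real n)) powr (- 1 / (2 * \<alpha> + 1))"
    and L_def: "\<And>n. L n = nat \<lfloor>log 2 (1 / h n)\<rfloor>"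
    and pos_consts: "0 < a" "0 < c1" "0 < c2"
    and prior_par: "\<And>n k. k < 2 ^ L n \<Longrightarrow>
          c1 * 2 powr (- real (L n) * a) \<le> \<alpha>p n k \<and> \<alpha>p n k \<le> c2"
  shows "\<forall>M :: nat \<Rightarrow> real. filterlim M at_top sequentially \<longrightarrow>
     (\<lambda>n. \<integral>\<^sup>+ xs. hist_posterior (L n) (\<alpha>p n) n xs
              {f. sup_dist01 f f0 > M n * (ln (real n) / real n) powr (\<alpha> / (2 * \<alpha> + 1))}
           \<partial>iid_sample f0 n) \<longlonglongrightarrow> 0"
proof (intro allI impI)
  fix M :: "nat \<Rightarrow> real" assume M: "filterlim M at_top sequentially"
  define Q where "Q = density lborel (\<lambda>x. ennreal (f0 x * indicator {0..1} x))"
  define \<epsilon> where "\<epsilon> = (\<lambda>n. (ln (real n) / real n) powr (\<alpha> / (2 * \<alpha> + 1)))"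
  define B where "B = (\<lambda>n. {f. sup_dist01 f f0 > M n * \<epsilon> n})"
  obtain C0 where C0: "\<And>x y. x \<in> {0..1} \<Longrightarrow> y \<in> {0..1} \<Longrightarrow> \<bar>f0 x - f0 y\<bar> \<le> C0 * \<bar>x - y\<bar> powr \<alpha>"
    using hol unfolding holder01_def by blast
  \<comment> \<open>A nonnegative Hoelder constant makes the bound monotone in the distance.\<close>
  define C where "C = \<bar>C0\<bar>"
  have C: "\<bar>f0 x - f0 y\<bar> \<le> C * \<bar>x - y\<bar> powr \<alpha>" if "x \<in> {0..1}" "y \<in> {0..1}" for x y
  proof -
    have "C0 * \<bar>x - y\<bar> powr \<alpha> \<le> C * \<bar>x - y\<bar> powr \<alpha>"
      unfolding C_def by (intro mult_right_mono) auto
    then show ?thesis using C0[OF that] by linarith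
  qed
  have C_nonneg: "0 \<le> C" by (simp add: C_def)
  have D0: "0 < D0" "\<rho>0 \<le> D0" using bounds(1) bounds(2)[of 0] by auto
  \<comment> \<open>The constant 512 turns the factor \<open>exp (- n * t\<^sup>2 / (256 * P))\<close> into \<open>n\<^sup>-\<^sup>2\<close>.\<close>
  define \<tau> where "\<tau> = sqrt (512 * D0)"
  have \<tau>: "0 < \<tau>" "\<tau>\<^sup>2 = 512 * D0" using D0 by (auto simp: \<tau>_def)

  \<comment> \<open>Bin masses and bias\<close>
  have f_meas [measurable]: "(\<lambda>x. f0 x * indicator {0..1} x) \<in> borel_measurable borel"
    using borel_measurable_continuous_on_indicator[OF _ holder01_imp_continuous_on[OF hol]] alpha
    by (simp add: mult.commute)
  have Q: "prob_space Q" "sets Q = sets borel"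
    using dens by (auto simp: Q_def emeasure_density intro!: prob_spaceI)
  have Q_unit: "AE x in Q. x \<in> {0..1}"
    unfolding Q_def by (subst AE_density, measurable) (auto simp: indicator_def)

  have p_bounds: "\<rho>0 * (1 / 2 ^ l) \<le> measure Q (dyadic_interval l k)"
      "measure Q (dyadic_interval l k) \<le> D0 * (1 / 2 ^ l)"
    if k: "k < 2 ^ l" for k l
    unfolding Q_def using dyadic_interval_geometry[OF k] bounds D0
    by (intro measure_density_bounds; force simp: dyadic_interval_def)+
  \<comment> \<open>The scaled mass is the average of \<open>f0\<close> over the bin, where
    \<open>f0\<close> stays within the Hoelder bound of its value at x.\<close>
  have bias: "\<bar>2 ^ l * measure Q (dyadic_interval l k) - f0 x\<bar> \<le> C * (1 / 2 ^ l) powr \<alpha>"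
    if k: "k < 2 ^ l" and x: "x \<in> dyadic_interval l k" for k l x
  proof -
    let ?b = "C * (1 / 2 ^ l) powr \<alpha>"
    have near: "\<bar>f0 y - f0 x\<bar> \<le> ?b" if y: "y \<in> dyadic_interval l k" for y
    proof -
      have "\<bar>f0 y - f0 x\<bar> \<le> C * \<bar>y - x\<bar> powr \<alpha>"
        using dyadic_interval_geometry(1)[OF k] x y by (intro C) auto
      also have "\<dots> \<le> ?b"
        using dyadic_interval_geometry(3)[OF k y x] alpha C_nonneg by (intro mult_left_mono powr_mono2) auto
      finally show ?thesis .
    qed
    have x01: "x \<in> {0..1}" using dyadic_interval_geometry(1)[OF k] x by auto
    have b: "0 \<le> ?b" using C_nonneg by simp
    \<comment> \<open>The maximum with 0 meets the requirement of a nonnegative lower bound in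
      \<open>measure_density_bounds\<close>.\<close>
    have lo: "max 0 (f0 x - ?b) * (1 / 2 ^ l) \<le> measure Q (dyadic_interval l k)"
      and hi: "measure Q (dyadic_interval l k) \<le> (f0 x + ?b) * (1 / 2 ^ l)"
    proof -
      have fb: "max 0 (f0 x - ?b) \<le> f0 y \<and> f0 y \<le> f0 x + ?b" if y: "y \<in> dyadic_interval l k" for y
      proof -
        have "0 \<le> f0 y" using bounds(1) bounds(2)[of y] dyadic_interval_geometry(1)[OF k] y by auto
        then show ?thesis using near[OF y] by (auto simp: abs_le_iff)
      qed
      have "max 0 (f0 x - ?b) \<le> f0 x + ?b" using fb[OF x] by linarith
      note * = measure_density_bounds[OF f_meas _ dyadic_interval_geometry(1)[OF k]
          dyadic_interval_geometry(2)[OF k] _ fb _ this]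
      show "max 0 (f0 x - ?b) * (1 / 2 ^ l) \<le> measure Q (dyadic_interval l k)"
        unfolding Q_def by (rule *(1)) (auto simp: dyadic_interval_def)
      show "measure Q (dyadic_interval l k) \<le> (f0 x + ?b) * (1 / 2 ^ l)"
        unfolding Q_def by (rule *(2)) (auto simp: dyadic_interval_def)
    qed
    have "f0 x - ?b \<le> 2 ^ l * measure Q (dyadic_interval l k)"
      using lo by (simp add: field_simps)
    moreover have "2 ^ l * measure Q (dyadic_interval l k) \<le> f0 x + ?b"
      using hi by (simp add: field_simps)
    ultimately show ?thesis by (simp add: abs_le_iff)
  qed

  \<comment> \<open>Choice of the threshold and the rate\<close>
  have ln_top: "filterlim (\<lambda>n. ln (real n)) at_top sequentially"
    using filterlim_compose[OF ln_at_top filterlim_real_sequentially] .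
  have eps0: "\<epsilon> \<longlonglongrightarrow> 0"
  proof -
    have "(\<lambda>n. ln (real n) / real n) \<longlonglongrightarrow> 0" by (rule lim_ln_over_n)
    then show ?thesis unfolding \<epsilon>_def
      using alpha by (intro tendsto_zero_powrI eventually_sequentiallyI[of 1]) auto
  qed
  \<comment> \<open>Three conditions for large n: \<open>M n\<close> exceeds the stochastic constant
    \<tau> plus the bias constant 2 C; ln n is large enough for the lower bounds on nt; and
    \<epsilon> is so small that every bin mass is at least 2 t.\<close>
  have "\<forall>\<^sub>F n in sequentially. \<tau> + 2 * C \<le> M n"
    using M by (simp add: filterlim_at_top)
  moreover have "\<forall>\<^sub>F n in sequentially. max 1 (max (32 / \<tau>) (max (8 * c2 / \<tau>) (8 * (c2 * D0) / \<tau>))) \<le> ln (real n)"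
    using ln_top by (simp only: filterlim_at_top)
  moreover have "\<forall>\<^sub>F n in sequentially. \<epsilon> n < \<rho>0 / (2 * \<tau>)"
    using eps0 bounds(1) \<tau>(1) by (intro order_tendstoD) auto
  ultimately have upper: "\<forall>\<^sub>F n in sequentially.
      (\<integral>\<^sup>+ xs. hist_posterior (L n) (\<alpha>p n) n xs (B n) \<partial>iid_sample f0 n) \<le> ennreal (4 / real n)"
  proof eventually_elim
    case (elim n)
    define \<delta> :: real where "\<delta> = 1 / 2 ^ L n"
    \<comment> \<open>A deviation t of a weight is a deviation \<tau> \<epsilon> of the height of
      the histogram, because heights are weights divided by the bin width \<delta>.\<close>
    define t where "t = \<tau> * \<epsilon> n * \<delta>"
    have ln1: "1 \<le> ln (real n)" and ln2: "32 \<le> \<tau> * ln (real n)" "8 * c2 \<le> \<tau> * ln (real n)"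
        "8 * (c2 * D0) \<le> \<tau> * ln (real n)"
      using elim(2) \<tau>(1) by (auto simp: field_simps)
    have n0: "0 < real n" using ln1 by (cases n) auto
    have \<alpha>0: "0 < \<alpha>" using alpha by simp
    have "(ln (real n) / real n) powr (\<alpha> / (2 * \<alpha> + 1)) = \<epsilon> n" by (simp add: \<epsilon>_def)
    note bw = bandwidth_bounds[OF \<alpha>0 alpha(2) ln1 h_def L_def, unfolded this, folded \<delta>_def]
    have \<delta>: "0 < \<delta>" by (simp add: \<delta>_def)
    have "ln (real n) / real n \<noteq> 0" using ln1 n0 by auto
    then have e: "0 < \<epsilon> n" unfolding \<epsilon>_def by (simp only: powr_gt_zero not_False_eq_True)
    have t: "0 < t" using \<tau> e \<delta> by (simp add: t_def)
    have nt: "\<tau> * ln (real n) \<le> real n * t"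
      using mult_left_mono[OF bw(3), of \<tau>] \<tau>(1) by (simp add: t_def mult_ac)
    have "(\<integral>\<^sup>+ xs. hist_posterior (L n) (\<alpha>p n) n xs (B n) \<partial>PiM {..<n} (\<lambda>_. Q))
      \<le> ennreal (4 * 2 ^ L n * exp (- (real n * t\<^sup>2 / (256 * (D0 * \<delta>)))))"
    \<comment> \<open>P is instantiated to D0 \<delta>, the bound on every bin mass, so that P times
      the number of bins is D0.\<close>
    proof (rule nn_integral_hist_posterior_le[where c = c2 and D = D0, OF Q Q_unit])
      show "0 < \<alpha>p n k \<and> \<alpha>p n k \<le> c2" if "k < 2 ^ L n" for k
      proof -
        have "0 < c1 * 2 powr (- real (L n) * a)" using pos_consts by simp
        then show ?thesis using prior_par[OF that] by linarith
      qed
      show "2 * t \<le> measure Q (dyadic_interval (L n) k)" if "k < 2 ^ L n" for k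
      proof -
        have "2 * t = (2 * \<tau> * \<epsilon> n) * \<delta>" by (simp add: t_def)
        also have "\<dots> \<le> \<rho>0 * \<delta>"
          using elim(3) \<tau>(1) \<delta> by (intro mult_right_mono) (auto simp: field_simps)
        finally show ?thesis using p_bounds(1)[OF that] by (simp add: \<delta>_def)
      qed
      show "measure Q (dyadic_interval (L n) k) \<le> D0 * \<delta>" if "k < 2 ^ L n" for k
        using p_bounds(2)[OF that] by (simp add: \<delta>_def)
      show "D0 * \<delta> * 2 ^ L n \<le> D0" by (simp add: \<delta>_def)
      show "32 \<le> real n * t" "8 * c2 \<le> real n * t" "8 * (c2 * D0) \<le> real n * t"
        using nt ln2 by linarith+
      show "histogram (L n) w \<notin> B n"
        if w: "\<forall>k<2 ^ L n. \<bar>w k - measure Q (dyadic_interval (L n) k)\<bar> \<le> t" for w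
      proof -
        \<comment> \<open>Triangle inequality through the scaled bin mass: \<tau> \<epsilon> comes
          from the weights and 2 C \<epsilon> from the bias.\<close>
        have "\<bar>histogram (L n) w x - f0 x\<bar> \<le> M n * \<epsilon> n" if x: "x \<in> {0..1}" for x
        proof -
          define k where "k = dyadic_index (L n) x"
          have k: "k < 2 ^ L n" "x \<in> dyadic_interval (L n) k"
            using dyadic_index_less[OF x] mem_dyadic_interval_iff[OF x] by (auto simp: k_def)
          let ?p = "measure Q (dyadic_interval (L n) k)"
          have "2 ^ L n * \<bar>w k - ?p\<bar> \<le> 2 ^ L n * t" using w k by (intro mult_left_mono) auto
          also have "\<dots> = \<tau> * \<epsilon> n" by (simp add: t_def \<delta>_def)
          finally have 1: "\<bar>2 ^ L n * w k - 2 ^ L n * ?p\<bar> \<le> \<tau> * \<epsilon> n"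
            by (simp add: right_diff_distrib[symmetric] abs_mult)
          have "\<bar>2 ^ L n * ?p - f0 x\<bar> \<le> C * \<delta> powr \<alpha>" using bias[OF k] by (simp add: \<delta>_def)
          also have "\<dots> \<le> C * (2 * \<epsilon> n)" using bw(2) C_nonneg by (intro mult_left_mono) auto
          finally have 2: "\<bar>2 ^ L n * ?p - f0 x\<bar> \<le> 2 * C * \<epsilon> n" by simp
          have "\<bar>2 ^ L n * w k - f0 x\<bar> \<le> \<tau> * \<epsilon> n + 2 * C * \<epsilon> n" using 1 2 by linarith
          also have "\<dots> = (\<tau> + 2 * C) * \<epsilon> n" by (simp add: algebra_simps)
          also have "\<dots> \<le> M n * \<epsilon> n" using elim(1) e by (intro mult_right_mono) auto
          finally show ?thesis by (simp add: histogram_eq[OF x] k_def)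
        qed
        then have "sup_dist01 (histogram (L n) w) f0 \<le> M n * \<epsilon> n"
          unfolding sup_dist01_def by (intro cSUP_least) auto
        then show ?thesis by (simp add: B_def)
      qed
    qed (fact t)
    also have "\<dots> \<le> ennreal (4 / real n)"
    proof (rule ennreal_leI)
      \<comment> \<open>By \<open>bw(4)\<close> this is at least 2 ln n, so the exponential is at
        most 1/n^2, and the at most n bins leave 4/n.\<close>
      have "real n * t\<^sup>2 / (256 * (D0 * \<delta>)) = 2 * (real n * (\<epsilon> n)\<^sup>2 * \<delta>)"
        using D0 \<delta> by (simp add: t_def power_mult_distrib \<tau>(2) power2_eq_square[of \<delta>] field_simps)
      then have "2 * ln (real n) \<le> real n * t\<^sup>2 / (256 * (D0 * \<delta>))" using bw(4) by linarith
      then have "exp (- (real n * t\<^sup>2 / (256 * (D0 * \<delta>)))) \<le> exp (- (2 * ln (real n)))" by simp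
      also have "\<dots> = 1 / (real n)\<^sup>2"
        using n0 by (simp add: exp_minus exp_double inverse_eq_divide)
      finally have "4 * 2 ^ L n * exp (- (real n * t\<^sup>2 / (256 * (D0 * \<delta>)))) \<le> 4 * real n * (1 / (real n)\<^sup>2)"
        using bw(1) by (intro mult_mono) auto
      then show "4 * 2 ^ L n * exp (- (real n * t\<^sup>2 / (256 * (D0 * \<delta>)))) \<le> 4 / real n"
        using n0 by (simp add: power2_eq_square)
    qed
    finally show ?case by (simp add: iid_sample_def Q_def)
  qed
  have lim: "(\<lambda>n. ennreal (4 / real n)) \<longlonglongrightarrow> 0"
  proof -
    have "(\<lambda>n. 4 / real n) \<longlonglongrightarrow> 0" by (rule lim_const_over_n)
    then have "(\<lambda>n. ennreal (4 / real n)) \<longlonglongrightarrow> ennreal 0" by (rule tendsto_ennrealI)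
    then show ?thesis by simp
  qed
  have "(\<lambda>n. \<integral>\<^sup>+ xs. hist_posterior (L n) (\<alpha>p n) n xs (B n) \<partial>iid_sample f0 n) \<longlonglongrightarrow> 0"
    by (rule tendsto_sandwich[OF always_eventually upper tendsto_const lim]) simp
  then show "(\<lambda>n. \<integral>\<^sup>+ xs. hist_posterior (L n) (\<alpha>p n) n xs
              {f. sup_dist01 f f0 > M n * (ln (real n) / real n) powr (\<alpha> / (2 * \<alpha> + 1))}
           \<partial>iid_sample f0 n) \<longlonglongrightarrow> 0"
    unfolding B_def \<epsilon>_def .
qed

end
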